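(* Let $\psi$ be a primitive Dirichlet character mod $q$ with $q>1$ and $\psi(-1)=1$ (i.e. $\psi(q-1)=1$). For each $n\geq1$ put $$S_n=\sum_{\substack{m=1\\ \gcd(m,n)=1}}^{\lfloor\frac{nq-1}{2}\rfloor}\psi(m)\,\chi_{(\frac{2m}{nq},1)}.$$ (1) If $v$ is a product of some distinct primes and $\gcd(v,q)=1$, then $S_v\in\mathcal{C}$. (2) Let $u$ be a positive even integer and let $\{c_d:d\mid u\}$ be complex numbers with $|c_1|>(\mathbf d(uu')-1)\cdot\max\{|c_d|:d\mid u,\ d>1\}$, where $u'$ is the largest divisor of $u$ relatively prime to $q$ and $\mathbf d(n)$ is the number of positive divisors of $n$. Then $\sum_{d\mid u}c_dS_d\in\mathcal{C}$.
   Context: $\chi_A$ is the characteristic function of $A\subseteq(0,1)$. $L^2=L^2(0,1)$; functions are identified with their odd $2$-periodic extensions to $\mathbb{R}$; $\mathcal{C}$ is the set of $\varphi\in L^2$ such that the span of $\{\varphi(kx):k\in\mathbb{N}\}$ is dense in $L^2$. A Dirichlet character mod $q$ is a completely multiplicative $q$-periodic function $\chi$ on $\mathbb{N}$ with $\chi(n)\ne0$ iff $\gcd(n,q)=1$ (extended $q$-periodically to $\mathbb{Z}$); it is primitive if it is not of the form $\psi\chi_q$ with $\psi$ a character of modulus a proper divisor of $q$ and $\chi_q$ the principal character mod $q$. *)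

theory Defs
  imports "HOL-Analysis.Analysis" "HOL-Computational_Algebra.Squarefree"
begin

definition L2_01 :: "(real \<Rightarrow> complex) set" where
  "L2_01 = {f. f \<in> borel_measurable (lebesgue_on {0<..<1}) \<and>
               integrable (lebesgue_on {0<..<1}) (\<lambda>x. (norm (f x))^2)}"

definition odd_ext :: "(real \<Rightarrow> complex) \<Rightarrow> real \<Rightarrow> complex" where
  "odd_ext f x = (let y = x - 2 * of_int \<lfloor>x / 2\<rfloor> in
      if 0 < y \<and> y < 1 then f y
      else if 1 < y \<and> y < 2 then - f (2 - y) else 0)"

definition cyclic_C :: "(real \<Rightarrow> complex) \<Rightarrow> bool" where
  "cyclic_C \<phi> \<longleftrightarrow> \<phi> \<in> L2_01 \<and>
     (\<forall>g\<in>L2_01. \<forall>\<epsilon>>0. \<exists>(N::nat) (a::nat \<Rightarrow> complex).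
        (LINT x|lebesgue_on {0<..<1}.
           (norm (g x - (\<Sum>k\<in>{1..N}. a k * odd_ext \<phi> (real k * x))))^2) < \<epsilon>)"

definition dirichlet_char :: "nat \<Rightarrow> (nat \<Rightarrow> complex) \<Rightarrow> bool" where
  "dirichlet_char q chr \<longleftrightarrow> q > 0 \<and>
     (\<forall>m n. chr (m * n) = chr m * chr n) \<and>
     (\<forall>n. chr (n + q) = chr n) \<and>
     (\<forall>n. chr n \<noteq> 0 \<longleftrightarrow> coprime n q)"

definition principal_char :: "nat \<Rightarrow> nat \<Rightarrow> complex" where
  "principal_char q n = (if coprime n q then 1 else 0)"

definition primitive_char :: "nat \<Rightarrow> (nat \<Rightarrow> complex) \<Rightarrow> bool" where
  "primitive_char q chr \<longleftrightarrow> dirichlet_char q chr \<and>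
     \<not> (\<exists>d \<psi>. d dvd q \<and> d < q \<and> dirichlet_char d \<psi> \<and>
              (\<forall>n. chr n = \<psi> n * principal_char q n))"

definition S_fun :: "(nat \<Rightarrow> complex) \<Rightarrow> nat \<Rightarrow> nat \<Rightarrow> real \<Rightarrow> complex" where
  "S_fun \<psi> q n x = (\<Sum>m\<in>{m\<in>{1..(n * q - 1) div 2}. coprime m n}.
      \<psi> m * (if 2 * real m / real (n * q) < x \<and> x < 1 then 1 else 0))"

definition num_divisors :: "nat \<Rightarrow> nat" where
  "num_divisors n = card {d. d dvd n}"

end

theory Submission
  imports Defs "HOL-Library.Function_Algebras" "HOL-Number_Theory.Residues"
begin

text \<open>
  Write $T_k$ for the isometry $f(x) \mapsto f(kx)$. On irrational points $S_n(x)$ is the character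
  sum of $\psi$ over $m \le nqx/2$ prime to $n$, so sieving by one more prime gives
  $S_{pn} = T_p S_n - \psi(p) S_n$ if $p \nmid n$ and $S_{pn} = T_p S_n$ otherwise.
  Hence every $S_n$ is a polynomial in dilations applied to $S_1$, and this polynomial can be inverted
  in the closed dilation-invariant subspace generated by the function in question: for (1) the factors
  $1 - cT_p$ with $|c| = 1$ have dense range (Cesaro means of $c^jT_p^j$ tend to $0$ strongly), for (2)
  a Neumann series converges. So the subspace contains $S_1$. By the Gauss sum formula the $k$-th
  sine coefficient of $S_1$ is a nonzero constant times $\overline{\psi(k)}/k$, which is completely
  multiplicative; applying $\prod_{p \le P} (1 - \overline{\psi(p)} p^{-1} T_p)$ and letting
  $P \to \infty$ produces $\sin(\pi x)$, whose dilates span a dense subspace.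
\<close>

section \<open>Square-integrable functions\<close>

definition fscale :: "complex \<Rightarrow> ('a \<Rightarrow> complex) \<Rightarrow> 'a \<Rightarrow> complex" (infixr "*\<^sub>F" 75) where
  "c *\<^sub>F f = (\<lambda>x. c * f x)"

lemma fscale_apply [simp]: "(c *\<^sub>F f) x = c * f x"
  by (simp add: fscale_def)

global_interpretation cfun: vector_space fscale
  by unfold_locales (simp_all add: fun_eq_iff algebra_simps)

lemma sum_fun_apply: "(\<Sum>i\<in>I. f i) x = (\<Sum>i\<in>I. f i x :: complex)"
  by (induction I rule: infinite_finite_induct) simp_all

definition square_integrable :: "'a measure \<Rightarrow> ('a \<Rightarrow> complex) set" where
  "square_integrable M = {f \<in> borel_measurable M. integrable M (\<lambda>x. (norm (f x))\<^sup>2)}"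

definition l2_norm :: "'a measure \<Rightarrow> ('a \<Rightarrow> complex) \<Rightarrow> real" where
  "l2_norm M f = sqrt (LINT x|M. (norm (f x))\<^sup>2)"

definition l2_inner :: "'a measure \<Rightarrow> ('a \<Rightarrow> complex) \<Rightarrow> ('a \<Rightarrow> complex) \<Rightarrow> complex" where
  "l2_inner M f g = (LINT x|M. f x * cnj (g x))"

lemma square_integrable_measurable: "f \<in> square_integrable M \<Longrightarrow> f \<in> borel_measurable M"
  and square_integrable_integrable: "f \<in> square_integrable M \<Longrightarrow> integrable M (\<lambda>x. (norm (f x))\<^sup>2)"
  by (simp_all add: square_integrable_def)

lemma l2_norm_nonneg [simp]: "l2_norm M f \<ge> 0"
  by (simp add: l2_norm_def)

lemma l2_norm_square: "(l2_norm M f)\<^sup>2 = (LINT x|M. (norm (f x))\<^sup>2)"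
  by (simp add: l2_norm_def)

lemma l2_norm_zero [simp]: "l2_norm M 0 = 0"
  by (simp add: l2_norm_def)

lemma l2_norm_fscale: "l2_norm M (c *\<^sub>F f) = norm c * l2_norm M f"
  by (simp add: l2_norm_def norm_mult power_mult_distrib real_sqrt_mult)

lemma l2_norm_minus [simp]: "l2_norm M (- f) = l2_norm M f"
  by (simp add: l2_norm_def)

lemma l2_norm_eq_0_AE: "AE x in M. f x = g x \<Longrightarrow> l2_norm M (f - g) = 0"
  by (simp add: l2_norm_def integral_eq_zero_AE)

lemma l2_norm_tendsto_0_comparison:
  fixes r :: "nat \<Rightarrow> real"
  assumes "\<And>n. l2_norm M (f n) \<le> r n" "r \<longlonglongrightarrow> 0"
  shows "(\<lambda>n. l2_norm M (f n)) \<longlonglongrightarrow> 0"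
  by (rule tendsto_sandwich[OF _ _ tendsto_const assms(2)]) (simp_all add: assms(1))

lemma integrable_mult_square_integrable:
  assumes "f \<in> square_integrable M" "g \<in> square_integrable M"
  shows "integrable M (\<lambda>x. f x * g x)"
proof (rule Bochner_Integration.integrable_bound)
  show "integrable M (\<lambda>x. (norm (f x))\<^sup>2 + (norm (g x))\<^sup>2)"
    using assms by (intro Bochner_Integration.integrable_add square_integrable_integrable)
  show "AE x in M. norm (f x * g x) \<le> norm ((norm (f x))\<^sup>2 + (norm (g x))\<^sup>2)"
  proof (rule AE_I2)
    fix x
    have "norm (f x * g x) \<le> 2 * norm (f x) * norm (g x)"
      by (simp add: norm_mult)
    also have "\<dots> \<le> (norm (f x))\<^sup>2 + (norm (g x))\<^sup>2"
      by (rule sum_squares_bound)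
    finally show "norm (f x * g x) \<le> norm ((norm (f x))\<^sup>2 + (norm (g x))\<^sup>2)" by simp
  qed
qed (use assms in \<open>auto intro: square_integrable_measurable borel_measurable_times\<close>)

lemma square_integrable_cnj:
  assumes "f \<in> square_integrable M"
  shows "(\<lambda>x. cnj (f x)) \<in> square_integrable M"
proof -
  have [measurable]: "f \<in> borel_measurable M" using assms by (rule square_integrable_measurable)
  have "(\<lambda>x. cnj (f x)) \<in> borel_measurable M"
    by (rule borel_measurable_continuous_on[where f = cnj]) (auto intro: continuous_intros)
  then show ?thesis using assms by (simp add: square_integrable_def)
qed

lemma integrable_l2_inner:
  assumes "f \<in> square_integrable M" "g \<in> square_integrable M"
  shows "integrable M (\<lambda>x. f x * cnj (g x))"
  using assms by (intro integrable_mult_square_integrable square_integrable_cnj)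

lemma cmod_add_square: "(cmod (a + b))\<^sup>2 = (cmod a)\<^sup>2 + 2 * Re (a * cnj b) + (cmod b)\<^sup>2"
  unfolding cmod_power2 by (simp add: power2_eq_square algebra_simps)

lemma subspace_square_integrable: "cfun.subspace (square_integrable M)"
proof (rule cfun.subspaceI)
  fix f g assume fg: "f \<in> square_integrable M" "g \<in> square_integrable M"
  have "integrable M (\<lambda>x. (norm (f x))\<^sup>2 + 2 * Re (f x * cnj (g x)) + (norm (g x))\<^sup>2)"
    using fg by (intro Bochner_Integration.integrable_add integrable_mult_right integrable_Re
        integrable_l2_inner square_integrable_integrable)
  moreover have "f + g \<in> borel_measurable M"
    unfolding plus_fun_def using fg
    by (intro borel_measurable_add square_integrable_measurable)
  ultimately show "f + g \<in> square_integrable M" by (simp add: square_integrable_def cmod_add_square)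
next
  fix c f assume "f \<in> square_integrable M"
  then show "c *\<^sub>F f \<in> square_integrable M"
    by (auto simp: square_integrable_def fscale_def norm_mult power_mult_distrib)
qed (simp add: square_integrable_def zero_fun_def)

lemmas square_integrable_add = cfun.subspace_add[OF subspace_square_integrable]
  and square_integrable_diff = cfun.subspace_diff[OF subspace_square_integrable]
  and square_integrable_fscale = cfun.subspace_scale[OF subspace_square_integrable]
  and square_integrable_sum = cfun.subspace_sum[OF subspace_square_integrable]

lemma l2_norm_add_square:
  assumes "f \<in> square_integrable M" "g \<in> square_integrable M"
  shows "(l2_norm M (f + g))\<^sup>2 = (l2_norm M f)\<^sup>2 + 2 * Re (l2_inner M f g) + (l2_norm M g)\<^sup>2"
proof -
  define R where "R x = Re (f x * cnj (g x))" for x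
  have "integrable M R"
    unfolding R_def using assms by (intro integrable_Re integrable_l2_inner)
  moreover have "(LINT x|M. R x) = Re (l2_inner M f g)"
    unfolding R_def l2_inner_def using assms by (intro integral_Re integrable_l2_inner)
  moreover have "(norm ((f + g) x))\<^sup>2 = (norm (f x))\<^sup>2 + 2 * R x + (norm (g x))\<^sup>2" for x
    by (simp only: plus_fun_apply cmod_add_square R_def)
  ultimately show ?thesis
    using assms by (simp add: l2_norm_square square_integrable_integrable)
qed

lemma l2_inner_self: "l2_inner M f f = of_real ((l2_norm M f)\<^sup>2)"
  unfolding l2_inner_def l2_norm_square
  by (simp add: complex_norm_square[symmetric] flip: integral_complex_of_real)

lemma l2_inner_commute: "l2_inner M g f = cnj (l2_inner M f g)"
  unfolding l2_inner_def by (simp add: mult.commute flip: Bochner_Integration.integral_cnj)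

lemma l2_inner_fscale_right: "l2_inner M f (c *\<^sub>F g) = cnj c * l2_inner M f g"
  by (simp add: l2_inner_def mult.left_commute)

lemma l2_inner_minus_right: "l2_inner M f (- g) = - l2_inner M f g"
  by (simp add: l2_inner_def)

lemma l2_inner_sum_right:
  assumes "f \<in> square_integrable M" "\<And>i. i \<in> I \<Longrightarrow> g i \<in> square_integrable M"
  shows "l2_inner M f (\<Sum>i\<in>I. g i) = (\<Sum>i\<in>I. l2_inner M f (g i))"
  unfolding l2_inner_def sum_fun_apply cnj_sum sum_distrib_left
  using assms by (intro Bochner_Integration.integral_sum integrable_l2_inner)

lemma l2_norm_diff_square:
  assumes "f \<in> square_integrable M" "g \<in> square_integrable M"
  shows "(l2_norm M (f - g))\<^sup>2 = (l2_norm M f)\<^sup>2 - 2 * Re (l2_inner M f g) + (l2_norm M g)\<^sup>2"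
  using l2_norm_add_square[of f M "- g"] assms
  by (simp add: l2_inner_minus_right cfun.subspace_neg[OF subspace_square_integrable])

lemma Cauchy_Schwarz_l2_inner:
  assumes f: "f \<in> square_integrable M" and g: "g \<in> square_integrable M"
  shows "norm (l2_inner M f g) \<le> l2_norm M f * l2_norm M g"
proof (rule power2_le_imp_le)
  let ?I = "LINT x|M. norm (f x) * norm (g x)"
  have [measurable]: "f \<in> borel_measurable M" "g \<in> borel_measurable M"
    using f g by (auto intro: square_integrable_measurable)
  have square: "(\<integral>\<^sup>+x. ennreal ((norm (h x))\<^sup>2) \<partial>M) = ennreal ((l2_norm M h)\<^sup>2)"
    if "h \<in> square_integrable M" for h
    using square_integrable_integrable[OF that]
    by (simp add: nn_integral_eq_integral l2_norm_square)
  have "integrable M (\<lambda>x. norm (f x) * norm (g x))"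
    using integrable_norm[OF integrable_mult_square_integrable[OF f g]] by (simp add: norm_mult)
  then have "(\<integral>\<^sup>+x. ennreal (norm (f x)) * ennreal (norm (g x)) \<partial>M) = ennreal ?I"
    by (simp add: nn_integral_eq_integral flip: ennreal_mult)
  then have "ennreal (?I\<^sup>2) \<le> ennreal ((l2_norm M f)\<^sup>2 * (l2_norm M g)\<^sup>2)"
    using Cauchy_Schwarz_nn_integral[of "\<lambda>x. ennreal (norm (f x))" M "\<lambda>x. ennreal (norm (g x))"]
    by (simp add: square[OF f] square[OF g] ennreal_mult ennreal_power)
  then have "?I\<^sup>2 \<le> (l2_norm M f * l2_norm M g)\<^sup>2"
    by (simp add: power_mult_distrib)
  moreover have "norm (l2_inner M f g) \<le> ?I"
    unfolding l2_inner_def using integral_norm_bound[of M "\<lambda>x. f x * cnj (g x)"] by (simp add: norm_mult)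
  ultimately show "(norm (l2_inner M f g))\<^sup>2 \<le> (l2_norm M f * l2_norm M g)\<^sup>2"
    by (meson norm_ge_zero order_trans power_mono)
qed simp

lemma l2_norm_triangle:
  assumes "f \<in> square_integrable M" "g \<in> square_integrable M"
  shows "l2_norm M (f + g) \<le> l2_norm M f + l2_norm M g"
proof (rule power2_le_imp_le)
  have "Re (l2_inner M f g) \<le> l2_norm M f * l2_norm M g"
    using complex_Re_le_cmod Cauchy_Schwarz_l2_inner[OF assms] by (rule order_trans)
  then show "(l2_norm M (f + g))\<^sup>2 \<le> (l2_norm M f + l2_norm M g)\<^sup>2"
    by (simp add: l2_norm_add_square[OF assms] power2_sum)
qed simp

lemma l2_norm_diff_le:
  assumes "f \<in> square_integrable M" "g \<in> square_integrable M"
  shows "l2_norm M (f - g) \<le> l2_norm M f + l2_norm M g"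
  using l2_norm_triangle[OF assms(1) cfun.subspace_neg[OF subspace_square_integrable assms(2)]] by simp

lemma l2_norm_diff_triangle:
  assumes "f \<in> square_integrable M" "g \<in> square_integrable M" "h \<in> square_integrable M"
  shows "l2_norm M (f - h) \<le> l2_norm M (f - g) + l2_norm M (g - h)"
  using l2_norm_triangle[of "f - g" M "g - h"] assms by (simp add: square_integrable_diff)

lemma l2_norm_sum_le:
  assumes "\<And>i. i \<in> I \<Longrightarrow> f i \<in> square_integrable M"
  shows "l2_norm M (\<Sum>i\<in>I. f i) \<le> (\<Sum>i\<in>I. l2_norm M (f i))"
  using assms
proof (induction I rule: infinite_finite_induct)
  case (insert i I)
  have "l2_norm M (f i + (\<Sum>i\<in>I. f i)) \<le> l2_norm M (f i) + l2_norm M (\<Sum>i\<in>I. f i)"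
    using insert.prems by (intro l2_norm_triangle square_integrable_sum) auto
  also have "\<dots> \<le> l2_norm M (f i) + (\<Sum>i\<in>I. l2_norm M (f i))"
    using insert by simp
  finally show ?case by (simp only: sum.insert[OF insert.hyps])
qed simp_all

lemma (in finite_measure) square_integrable_bounded:
  assumes [measurable]: "f \<in> borel_measurable M" and "\<And>x. x \<in> space M \<Longrightarrow> norm (f x) \<le> B"
  shows "f \<in> square_integrable M"
proof -
  have "integrable M (\<lambda>x. (norm (f x))\<^sup>2)"
    using assms(2) by (intro integrable_const_bound[where B = "B\<^sup>2"] AE_I2) (auto simp: power_mono)
  then show ?thesis using assms(1) by (simp add: square_integrable_def)
qed

lemma (in finite_measure) l2_norm_le_bounded:
  assumes "f \<in> borel_measurable M" "\<And>x. x \<in> space M \<Longrightarrow> norm (f x) \<le> B" "B \<ge> 0"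
  shows "l2_norm M f \<le> B * sqrt (measure M (space M))"
proof -
  have "(LINT x|M. (norm (f x))\<^sup>2) \<le> (LINT x|M. B\<^sup>2)"
    using assms
    by (intro integral_mono square_integrable_integrable square_integrable_bounded[of f B])
       (auto intro: power_mono)
  then have "l2_norm M f \<le> sqrt (measure M (space M) * B\<^sup>2)"
    unfolding l2_norm_def by (intro real_sqrt_le_mono) simp
  then show ?thesis using assms(3) by (simp add: real_sqrt_mult mult.commute)
qed

lemma l2_norm_tendsto_0_dominated:
  fixes g :: "nat \<Rightarrow> 'a \<Rightarrow> complex"
  assumes [measurable]: "f \<in> borel_measurable M" "\<And>n. g n \<in> borel_measurable M"
    and w_integrable: "integrable M w"
    and dominated: "\<And>n x. x \<in> space M \<Longrightarrow> (norm (f x - g n x))\<^sup>2 \<le> w x"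
    and converges: "AE x in M. (\<lambda>n. g n x) \<longlonglongrightarrow> f x"
  shows "(\<lambda>n. l2_norm M (f - g n)) \<longlonglongrightarrow> 0"
proof -
  have "(\<lambda>n. LINT x|M. (norm (f x - g n x))\<^sup>2) \<longlonglongrightarrow> (LINT x|M. 0)"
  proof (rule integral_dominated_convergence[OF _ _ w_integrable])
    show "AE x in M. (\<lambda>n. (norm (f x - g n x))\<^sup>2) \<longlonglongrightarrow> 0"
      using converges
    proof eventually_elim
      fix x assume "(\<lambda>n. g n x) \<longlonglongrightarrow> f x"
      then have "(\<lambda>n. (norm (f x - g n x))\<^sup>2) \<longlonglongrightarrow> (norm (f x - f x))\<^sup>2"
        by (intro tendsto_intros)
      then show "(\<lambda>n. (norm (f x - g n x))\<^sup>2) \<longlonglongrightarrow> 0" by simp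
    qed
  qed (use dominated in auto)
  from tendsto_real_sqrt[OF this] show ?thesis by (simp add: l2_norm_def)
qed

definition l2_closure :: "'a measure \<Rightarrow> ('a \<Rightarrow> complex) set \<Rightarrow> ('a \<Rightarrow> complex) set" where
  "l2_closure M A = {f \<in> square_integrable M. \<forall>e>0. \<exists>g\<in>A. l2_norm M (f - g) < e}"

lemma l2_closureI:
  assumes "f \<in> square_integrable M" "\<And>e. e > 0 \<Longrightarrow> \<exists>g\<in>A. l2_norm M (f - g) < e"
  shows "f \<in> l2_closure M A"
  using assms by (simp add: l2_closure_def)

lemma l2_closureE:
  assumes "f \<in> l2_closure M A" "e > 0"
  obtains g where "g \<in> A" "l2_norm M (f - g) < e"
  using assms by (auto simp: l2_closure_def)

lemma l2_closure_square_integrable: "l2_closure M A \<subseteq> square_integrable M"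
  by (auto simp: l2_closure_def)

lemma l2_closure_mono: "A \<subseteq> B \<Longrightarrow> l2_closure M A \<subseteq> l2_closure M B"
  unfolding l2_closure_def by blast

lemma subset_l2_closure:
  assumes "A \<subseteq> square_integrable M"
  shows "A \<subseteq> l2_closure M A"
proof
  fix f assume "f \<in> A"
  then show "f \<in> l2_closure M A"
    using assms by (intro l2_closureI bexI[of _ f]) auto
qed

lemma l2_closure_sequentially:
  assumes "f \<in> square_integrable M" "\<And>n::nat. g n \<in> A" "(\<lambda>n. l2_norm M (f - g n)) \<longlonglongrightarrow> 0"
  shows "f \<in> l2_closure M A"
proof (rule l2_closureI[OF assms(1)])
  fix e :: real assume "e > 0"
  then obtain n where "l2_norm M (f - g n) < e"
    using LIMSEQ_D[OF assms(3), of e] by auto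
  then show "\<exists>g\<in>A. l2_norm M (f - g) < e" using assms(2) by blast
qed

lemma l2_closure_idem:
  assumes "A \<subseteq> square_integrable M"
  shows "l2_closure M (l2_closure M A) = l2_closure M A"
proof (intro equalityI subset_l2_closure l2_closure_square_integrable subsetI)
  fix f assume f: "f \<in> l2_closure M (l2_closure M A)"
  then have sq: "f \<in> square_integrable M" using l2_closure_square_integrable by blast
  then show "f \<in> l2_closure M A"
  proof (rule l2_closureI)
    fix e :: real assume "e > 0"
    then have half: "e / 2 > 0" by simp
    obtain g where g: "g \<in> l2_closure M A" "l2_norm M (f - g) < e / 2" using f half by (rule l2_closureE)
    obtain h where h: "h \<in> A" "l2_norm M (g - h) < e / 2" using g(1) half by (rule l2_closureE)
    have "l2_norm M (f - h) \<le> l2_norm M (f - g) + l2_norm M (g - h)"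
      using assms g(1) h(1) l2_closure_square_integrable
      by (intro l2_norm_diff_triangle sq) blast+
    then show "\<exists>h\<in>A. l2_norm M (f - h) < e" using g(2) h by (intro bexI[of _ h]) auto
  qed
qed

context
  fixes M :: "'a measure" and A
  assumes subspace_A: "cfun.subspace A" and A_square_integrable: "A \<subseteq> square_integrable M"
begin

lemma l2_closure_add:
  assumes f: "f \<in> l2_closure M A" and g: "g \<in> l2_closure M A"
  shows "f + g \<in> l2_closure M A"
proof (rule l2_closureI)
  have sq: "f \<in> square_integrable M" "g \<in> square_integrable M"
    using f g l2_closure_square_integrable by blast+
  then show "f + g \<in> square_integrable M" by (rule square_integrable_add)
  fix e :: real assume "e > 0"
  then have half: "e / 2 > 0" by simp
  obtain f' where f': "f' \<in> A" "l2_norm M (f - f') < e / 2" using f half by (rule l2_closureE)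
  obtain g' where g': "g' \<in> A" "l2_norm M (g - g') < e / 2" using g half by (rule l2_closureE)
  have "l2_norm M ((f - f') + (g - g')) \<le> l2_norm M (f - f') + l2_norm M (g - g')"
    using sq f'(1) g'(1) A_square_integrable by (intro l2_norm_triangle square_integrable_diff) auto
  then have "l2_norm M (f + g - (f' + g')) < e"
    using f'(2) g'(2) by (simp add: add_diff_add)
  then show "\<exists>h\<in>A. l2_norm M (f + g - h) < e"
    using cfun.subspace_add[OF subspace_A f'(1) g'(1)] by blast
qed

lemma l2_closure_fscale:
  assumes f: "f \<in> l2_closure M A"
  shows "c *\<^sub>F f \<in> l2_closure M A"
proof (rule l2_closureI)
  show "c *\<^sub>F f \<in> square_integrable M"
    using f l2_closure_square_integrable square_integrable_fscale by blast
  fix e :: real assume "e > 0"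
  have pos: "norm c + 1 > 0" by (simp add: add_nonneg_pos)
  obtain g where g: "g \<in> A" "l2_norm M (f - g) < e / (norm c + 1)"
    using f divide_pos_pos[OF \<open>e > 0\<close> pos] by (rule l2_closureE)
  have "l2_norm M (c *\<^sub>F f - c *\<^sub>F g) \<le> (norm c + 1) * l2_norm M (f - g)"
    by (simp add: l2_norm_fscale mult_right_mono flip: cfun.scale_right_diff_distrib)
  also have "\<dots> < e"
    using g(2) pos by (simp add: pos_less_divide_eq mult.commute)
  finally show "\<exists>h\<in>A. l2_norm M (c *\<^sub>F f - h) < e"
    using cfun.subspace_scale[OF subspace_A g(1)] by blast
qed

lemma subspace_l2_closure: "cfun.subspace (l2_closure M A)"
  using subset_l2_closure[OF A_square_integrable] cfun.subspace_0[OF subspace_A]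
  by (intro cfun.subspaceI l2_closure_add l2_closure_fscale) blast+

end

section \<open>Odd periodic functions and their dilations\<close>

abbreviation I01 :: "real measure" where "I01 \<equiv> lebesgue_on {0<..<1}"

abbreviation nrm :: "(real \<Rightarrow> complex) \<Rightarrow> real" where "nrm \<equiv> l2_norm I01"

lemma L2_01_eq: "L2_01 = square_integrable I01"
  by (auto simp: L2_01_def square_integrable_def)

lemma finite_measure_I01: "finite_measure I01"
  by (rule finite_measure_lebesgue_on) simp

lemma measure_I01 [simp]: "measure I01 {0<..<1} = 1"
  by (simp add: measure_restrict_space)

lemma borel_measurable_I01 [measurable (raw)]:
  "f \<in> borel_measurable borel \<Longrightarrow> f \<in> borel_measurable I01"
  by (intro measurable_restrict_space1 measurable_completion) simp

lemma nn_integral_I01: "(\<integral>\<^sup>+x. h x \<partial>I01) = (\<integral>\<^sup>+x. h x * indicator {0<..<1} x \<partial>lborel)"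
  by (simp add: nn_integral_restrict_space nn_integral_completion)

lemma AE_I01_irrational: "AE x in I01. x \<notin> \<rat>"
proof -
  have "AE x in lebesgue. x \<notin> (\<rat> :: real set)"
    by (intro AE_not_in null_sets_completionI countable_imp_null_set_lborel countable_rat)
  then show ?thesis by (auto simp: AE_restrict_space_iff elim: eventually_mono)
qed

locale even_two_periodic =
  fixes h :: "real \<Rightarrow> ennreal"
  assumes measurable_h [measurable]: "h \<in> borel_measurable borel"
    and even_h: "h (- x) = h x" and periodic_h: "h (x + 2) = h x"
begin

sublocale periodic_fun_simple h 2
  by unfold_locales (rule periodic_h)

lemma nn_integral_unit_interval:
  "(\<integral>\<^sup>+x. h x * indicator {real n<..<real n + 1} x \<partial>lborel) =
   (\<integral>\<^sup>+x. h x * indicator {0<..<1} x \<partial>lborel)"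
proof (cases "even n")
  case True
  then obtain m where n: "real n = real m * 2" by (auto elim!: evenE)
  have "h (real n + x) = h x" for x
    using plus_of_nat[of x m] by (simp add: n add.commute)
  moreover have "indicator {real n<..<real n + 1} (real n + x) = (indicator {0<..<1} x :: ennreal)" for x
    by (simp split: split_indicator)
  ultimately show ?thesis
    by (subst nn_integral_real_affine[of _ 1 "real n"]) simp_all
next
  case False
  then obtain m where n: "real n + 1 = real (m + 1) * 2" by (auto elim!: oddE)
  have "h (real n + 1 - x) = h x" for x
    using plus_of_nat[of "- x" "m + 1"] unfolding n[symmetric] by (simp add: even_h algebra_simps)
  moreover have "indicator {real n<..<real n + 1} (real n + 1 - x) = (indicator {0<..<1} x :: ennreal)" for x
    by (auto split: split_indicator)
  ultimately show ?thesis
    by (subst nn_integral_real_affine[of _ "-1" "real n + 1"]) simp_all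
qed

lemma nn_integral_Ioo:
  "(\<integral>\<^sup>+x. h x * indicator {0<..<real n} x \<partial>lborel) =
   of_nat n * (\<integral>\<^sup>+x. h x * indicator {0<..<1} x \<partial>lborel)"
proof (induction n)
  case (Suc n)
  have "AE x in lborel. x \<noteq> real n" by (rule AE_lborel_singleton)
  then have "(\<integral>\<^sup>+x. h x * indicator {0<..<real (Suc n)} x \<partial>lborel) =
      (\<integral>\<^sup>+x. h x * indicator {0<..<real n} x + h x * indicator {real n<..<real n + 1} x \<partial>lborel)"
    by (intro nn_integral_cong_AE, eventually_elim) (auto split: split_indicator)
  also have "\<dots> = (\<integral>\<^sup>+x. h x * indicator {0<..<real n} x \<partial>lborel) +
      (\<integral>\<^sup>+x. h x * indicator {real n<..<real n + 1} x \<partial>lborel)"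
    by (rule nn_integral_add) measurable
  finally show ?case
    using nn_integral_unit_interval[of n] by (simp add: Suc distrib_right add.commute)
qed simp

lemma nn_integral_dilation:
  assumes "k > 0"
  shows "(\<integral>\<^sup>+x. h (real k * x) \<partial>I01) = (\<integral>\<^sup>+x. h x \<partial>I01)"
proof -
  have "of_nat k * (\<integral>\<^sup>+x. h x \<partial>I01) = (\<integral>\<^sup>+x. h x * indicator {0<..<real k} x \<partial>lborel)"
    by (simp only: nn_integral_Ioo nn_integral_I01)
  also have "\<dots> = of_nat k * (\<integral>\<^sup>+x. h (real k * x) * indicator {0<..<real k} (real k * x) \<partial>lborel)"
    using assms by (subst nn_integral_real_affine[of _ "real k" 0]) (simp_all add: ennreal_of_nat_eq_real_of_nat)
  also have "\<dots> = of_nat k * (\<integral>\<^sup>+x. h (real k * x) \<partial>I01)"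
    using assms unfolding nn_integral_I01
    by (intro arg_cong[where f = "(*) (of_nat k)"] nn_integral_cong)
       (auto split: split_indicator simp: zero_less_mult_iff)
  finally show ?thesis
    using assms by (simp add: ennreal_mult_cancel_left)
qed

end

definition odd_periodic :: "(real \<Rightarrow> complex) set" where
  "odd_periodic = {f \<in> square_integrable I01.
      f \<in> borel_measurable borel \<and> (\<forall>x. f (- x) = - f x) \<and> (\<forall>x. f (x + 2) = f x)}"

lemma odd_periodic_square_integrable: "f \<in> odd_periodic \<Longrightarrow> f \<in> square_integrable I01"
  and odd_periodic_measurable: "f \<in> odd_periodic \<Longrightarrow> f \<in> borel_measurable borel"
  and odd_periodic_minus: "f \<in> odd_periodic \<Longrightarrow> f (- x) = - f x"
  and odd_periodic_plus_2: "f \<in> odd_periodic \<Longrightarrow> f (x + 2) = f x"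
  by (simp_all add: odd_periodic_def)

lemma subspace_odd_periodic: "cfun.subspace odd_periodic"
proof (rule cfun.subspaceI)
  show "0 \<in> odd_periodic"
    by (simp add: odd_periodic_def cfun.subspace_0[OF subspace_square_integrable]) (simp add: zero_fun_def)
next
  fix f g assume "f \<in> odd_periodic" "g \<in> odd_periodic"
  then show "f + g \<in> odd_periodic"
    by (simp add: odd_periodic_def square_integrable_add) (simp add: plus_fun_def borel_measurable_add)
next
  fix c f assume "f \<in> odd_periodic"
  then show "c *\<^sub>F f \<in> odd_periodic"
    by (simp add: odd_periodic_def square_integrable_fscale) (simp add: fscale_def borel_measurable_times)
qed

lemmas odd_periodic_add = cfun.subspace_add[OF subspace_odd_periodic]
  and odd_periodic_diff = cfun.subspace_diff[OF subspace_odd_periodic]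
  and odd_periodic_fscale = cfun.subspace_scale[OF subspace_odd_periodic]
  and odd_periodic_sum = cfun.subspace_sum[OF subspace_odd_periodic]

definition dil :: "nat \<Rightarrow> (real \<Rightarrow> complex) \<Rightarrow> real \<Rightarrow> complex" where
  "dil k f x = f (real k * x)"

global_interpretation dil: Vector_Spaces.linear fscale fscale "dil k" for k
  by unfold_locales (simp_all add: dil_def fun_eq_iff)

lemma dil_dil: "dil j (dil k f) = dil (j * k) f"
  by (simp add: dil_def fun_eq_iff mult_ac)

lemma dil_1 [simp]: "dil (Suc 0) f = f"
  by (simp add: dil_def fun_eq_iff)

lemma nn_integral_dil:
  assumes f: "f \<in> odd_periodic" and "k > 0"
  shows "(\<integral>\<^sup>+x. ennreal ((norm (dil k f x))\<^sup>2) \<partial>I01) = (\<integral>\<^sup>+x. ennreal ((norm (f x))\<^sup>2) \<partial>I01)"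
proof -
  have [measurable]: "f \<in> borel_measurable borel" using f by (rule odd_periodic_measurable)
  interpret even_two_periodic "\<lambda>x. ennreal ((norm (f x))\<^sup>2)"
    by unfold_locales (simp_all add: odd_periodic_minus[OF f] odd_periodic_plus_2[OF f])
  show ?thesis using nn_integral_dilation[OF assms(2)] by (simp add: dil_def)
qed

lemma odd_periodic_dil:
  assumes f: "f \<in> odd_periodic" and "k > 0"
  shows "dil k f \<in> odd_periodic"
proof -
  have [measurable]: "f \<in> borel_measurable borel" using f by (rule odd_periodic_measurable)
  have meas [measurable]: "dil k f \<in> borel_measurable borel"
    unfolding dil_def by measurable
  have "(\<integral>\<^sup>+x. ennreal ((norm (f x))\<^sup>2) \<partial>I01) < \<infinity>"
    using square_integrable_integrable[OF odd_periodic_square_integrable[OF f]]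
    by (simp add: integrable_iff_bounded)
  then have "dil k f \<in> square_integrable I01"
    using nn_integral_dil[OF assms] by (simp add: square_integrable_def integrable_iff_bounded)
  moreover interpret periodic_fun_simple f 2
    by unfold_locales (rule odd_periodic_plus_2[OF f])
  have "f (real k * (x + 2)) = f (real k * x)" for x
    using plus_of_nat[of "real k * x" k] by (simp add: algebra_simps)
  ultimately show ?thesis
    using meas f by (simp add: odd_periodic_def dil_def)
qed

lemma nrm_dil:
  assumes "f \<in> odd_periodic" "k > 0"
  shows "nrm (dil k f) = nrm f"
proof -
  have [measurable]: "f \<in> borel_measurable borel" "dil k f \<in> borel_measurable borel"
    using assms odd_periodic_dil odd_periodic_measurable by blast+
  show ?thesis
    unfolding l2_norm_def by (simp add: integral_eq_nn_integral nn_integral_dil[OF assms])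
qed

definition dilation_span :: "(real \<Rightarrow> complex) \<Rightarrow> (real \<Rightarrow> complex) set" where
  "dilation_span \<phi> = cfun.span ((\<lambda>k. dil k \<phi>) ` {0<..})"

lemma subspace_dilation_span: "cfun.subspace (dilation_span \<phi>)"
  by (simp add: dilation_span_def)

lemmas dilation_span_add = cfun.subspace_add[OF subspace_dilation_span]
  and dilation_span_fscale = cfun.subspace_scale[OF subspace_dilation_span]

lemma dil_in_dilation_span: "k > 0 \<Longrightarrow> dil k \<phi> \<in> dilation_span \<phi>"
  by (auto simp: dilation_span_def intro: cfun.span_base)

lemma dilation_span_minimal:
  assumes "cfun.subspace M" "\<And>k. k > 0 \<Longrightarrow> dil k \<phi> \<in> M"
  shows "dilation_span \<phi> \<subseteq> M"
  unfolding dilation_span_def using assms by (intro cfun.span_minimal) auto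

lemma dilation_span_odd_periodic: "\<phi> \<in> odd_periodic \<Longrightarrow> dilation_span \<phi> \<subseteq> odd_periodic"
  by (intro dilation_span_minimal subspace_odd_periodic odd_periodic_dil)

lemma dil_dilation_span:
  assumes "f \<in> dilation_span \<phi>" "k > 0"
  shows "dil k f \<in> dilation_span \<phi>"
proof -
  have "dilation_span \<phi> \<subseteq> dil k -` dilation_span \<phi>"
    using assms(2) by (intro dilation_span_minimal dil.subspace_vimage subspace_dilation_span)
      (simp add: dil_dil dil_in_dilation_span)
  then show ?thesis using assms(1) by blast
qed

lemma dilation_spanE:
  assumes "f \<in> dilation_span \<phi>"
  obtains N a where "f = (\<Sum>k=1..N. a k *\<^sub>F dil k \<phi>)"
proof -
  obtain T r where T: "finite T" "T \<subseteq> (\<lambda>k. dil k \<phi>) ` {0<..}" and f: "f = (\<Sum>g\<in>T. r g *\<^sub>F g)"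
    using assms unfolding dilation_span_def cfun.span_explicit by blast
  obtain K where K: "K \<subseteq> {0<..}" "inj_on (\<lambda>k. dil k \<phi>) K" "T = (\<lambda>k. dil k \<phi>) ` K"
    using T(2) unfolding subset_image_inj by blast
  then have fin: "finite K" using T(1) finite_image_iff by blast
  have "f = (\<Sum>k\<in>K. r (dil k \<phi>) *\<^sub>F dil k \<phi>)"
    unfolding f K(3) by (simp add: sum.reindex[OF K(2)])
  also have "\<dots> = (\<Sum>k=1..Max (insert 1 K). (if k \<in> K then r (dil k \<phi>) else 0) *\<^sub>F dil k \<phi>)"
  proof (rule sum.mono_neutral_cong_left)
    show "K \<subseteq> {1..Max (insert 1 K)}" using fin K(1) by (auto simp: Suc_le_eq)
  qed (auto simp: fin)
  finally show ?thesis by (rule that)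
qed

lemma odd_ext_conv_frac:
  "odd_ext f x = (let y = 2 * frac (x / 2) in
      if 0 < y \<and> y < 1 then f y else if 1 < y \<and> y < 2 then - f (2 - y) else 0)"
  by (simp add: odd_ext_def frac_def algebra_simps)

lemma odd_ext_minus: "odd_ext f (- x) = - odd_ext f x"
proof (cases "x / 2 \<in> \<int>")
  case True
  then have "frac (x / 2) = 0" "frac (- x / 2) = 0" by (auto simp: frac_eq_0_iff)
  then show ?thesis unfolding odd_ext_conv_frac by (simp only:) simp
next
  case False
  then have "2 * frac (- x / 2) = 2 - 2 * frac (x / 2)"
    by (simp add: frac_neg)
  then show ?thesis by (auto simp: odd_ext_conv_frac Let_def)
qed

lemma odd_ext_plus_2: "odd_ext f (x + 2) = odd_ext f x"
  using frac_1_eq[of "x / 2"] by (simp add: odd_ext_conv_frac add_divide_distrib)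

lemma odd_ext_eq: "0 < x \<Longrightarrow> x < 1 \<Longrightarrow> odd_ext f x = f x"
  by (simp add: odd_ext_def floor_unique[of 0 "x / 2"])

global_interpretation odd_ext: Vector_Spaces.linear fscale fscale odd_ext
  by unfold_locales (auto simp: odd_ext_def fun_eq_iff Let_def)

lemma odd_periodic_odd_ext:
  assumes [measurable]: "f \<in> borel_measurable borel" and f: "f \<in> square_integrable I01"
  shows "odd_ext f \<in> odd_periodic"
proof -
  have meas [measurable]: "odd_ext f \<in> borel_measurable borel"
    unfolding odd_ext_def Let_def by measurable
  have "integrable I01 (\<lambda>x. (norm (odd_ext f x))\<^sup>2) \<longleftrightarrow> integrable I01 (\<lambda>x. (norm (f x))\<^sup>2)"
    by (rule Bochner_Integration.integrable_cong) (auto simp: odd_ext_eq space_restrict_space)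
  then show ?thesis
    using f meas by (simp add: odd_periodic_def square_integrable_def odd_ext_minus odd_ext_plus_2)
qed

lemma odd_ext_unique_irrational:
  assumes eq: "\<And>x. 0 < x \<Longrightarrow> x < 1 \<Longrightarrow> x \<notin> \<rat> \<Longrightarrow> f x = g x"
    and odd: "\<And>x. x \<notin> \<rat> \<Longrightarrow> g (- x) = - g x" and periodic: "\<And>x. g (x + 2) = g x"
    and x: "x \<notin> \<rat>"
  shows "odd_ext f x = g x"
proof -
  interpret periodic_fun_simple g 2 by unfold_locales (rule periodic)
  define y where "y = x - 2 * of_int \<lfloor>x / 2\<rfloor>"
  have x_eq: "x = y + of_int \<lfloor>x / 2\<rfloor> * 2" by (simp add: y_def)
  have gy: "g y = g x" using plus_of_int[of y "\<lfloor>x / 2\<rfloor>"] by (simp flip: x_eq)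
  have y: "y \<notin> \<rat>"
  proof
    assume "y \<in> \<rat>"
    then have "x \<in> \<rat>" by (subst x_eq) (intro Rats_add Rats_mult Rats_of_int Rats_number_of)
    then show False using x by simp
  qed
  have "0 \<le> y" "y < 2" unfolding y_def by linarith+
  moreover have "y \<noteq> 0" "y \<noteq> 1" using y by auto
  ultimately consider "0 < y" "y < 1" | "1 < y" "y < 2" by linarith
  then show ?thesis
  proof cases
    case 1
    then show ?thesis using eq[of y] y gy by (simp add: odd_ext_def flip: y_def)
  next
    case 2
    have "2 - y \<notin> \<rat>" using y Rats_diff[of 2 "2 - y"] by auto
    then have "f (2 - y) = g (2 - y)" using eq[of "2 - y"] 2 by simp
    also have "\<dots> = - g y" using periodic[of "- y"] odd[OF y] by simp
    finally show ?thesis using 2 gy by (simp add: odd_ext_def flip: y_def)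
  qed
qed

section \<open>Sine coefficients\<close>

lemma
  fixes f F :: "real \<Rightarrow> real"
  assumes range: "0 \<le> a" "a \<le> 1" and deriv: "\<And>x. (F has_real_derivative f x) (at x)"
    and cont: "\<And>x. isCont f x"
  shows integrable_I01_continuous: "integrable I01 (\<lambda>x. indicator {a<..<1} x * f x)"
    and LINT_I01_FTC: "(LINT x|I01. indicator {a<..<1} x * f x) = F 1 - F a"
proof -
  have [measurable]: "f \<in> borel_measurable borel"
    using cont by (intro borel_measurable_continuous_onI continuous_at_imp_continuous_on ballI)
  have AE_eq: "AE x in lborel. indicator {a<..<1} x * f x = indicator {a..1} x * f x"
    using AE_lborel_singleton[of a] AE_lborel_singleton[of 1]
    by eventually_elim (auto split: split_indicator)
  have "(indicator {0<..<1} x :: real) * indicator {a<..<1} x = indicator {a<..<1} x" for x :: real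
    using range by (auto split: split_indicator)
  then have restrict: "indicator {0<..<1} x * (indicator {a<..<1} x * f x) = indicator {a<..<1} x * f x" for x
    by (simp flip: mult.assoc)
  have "has_bochner_integral lborel (\<lambda>x. f x * indicator {a..1} x) (F 1 - F a)"
    using range deriv cont by (intro has_bochner_integral_FTC_Icc_real) auto
  then have "has_bochner_integral lborel (\<lambda>x. indicator {a<..<1} x * f x) (F 1 - F a)"
    by (subst has_bochner_integral_cong_AE[OF _ _ AE_eq]) (simp_all add: mult.commute)
  then have "has_bochner_integral I01 (\<lambda>x. indicator {a<..<1} x * f x) (F 1 - F a)"
    by (simp add: has_bochner_integral_iff integrable_restrict_space integral_restrict_space restrict
        integrable_completion integral_completion)
  then show "integrable I01 (\<lambda>x. indicator {a<..<1} x * f x)"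
    "(LINT x|I01. indicator {a<..<1} x * f x) = F 1 - F a"
    by (simp_all add: has_bochner_integral_iff)
qed

lemma
  fixes n :: int
  shows integrable_cos_pi_int: "integrable I01 (\<lambda>x. cos (pi * (of_int n * x)))"
    and LINT_cos_pi_int: "(LINT x|I01. cos (pi * (of_int n * x))) = (if n = 0 then 1 else 0)"
proof -
  define F where "F x = (if n = 0 then x else sin (pi * (of_int n * x)) / (pi * of_int n))" for x :: real
  have "(F has_real_derivative cos (pi * (of_int n * x))) (at x)" for x
    unfolding F_def by (cases "n = 0") (auto intro!: derivative_eq_intros)
  then have "integrable I01 (\<lambda>x. indicator {0<..<1} x * cos (pi * (of_int n * x)))"
    "(LINT x|I01. indicator {0<..<1} x * cos (pi * (of_int n * x))) = F 1 - F 0"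
    by (auto intro!: integrable_I01_continuous LINT_I01_FTC continuous_intros)
  moreover have "integrable I01 (\<lambda>x. indicator {0<..<1} x * cos (pi * (of_int n * x))) \<longleftrightarrow>
      integrable I01 (\<lambda>x. cos (pi * (of_int n * x)))"
    by (rule Bochner_Integration.integrable_cong) (auto simp: space_restrict_space)
  moreover have "(LINT x|I01. indicator {0<..<1} x * cos (pi * (of_int n * x))) =
      (LINT x|I01. cos (pi * (of_int n * x)))"
    by (rule Bochner_Integration.integral_cong) (auto simp: space_restrict_space)
  ultimately show "integrable I01 (\<lambda>x. cos (pi * (of_int n * x)))"
    "(LINT x|I01. cos (pi * (of_int n * x))) = (if n = 0 then 1 else 0)"
    by (simp_all add: F_def)
qed

definition sine :: "nat \<Rightarrow> real \<Rightarrow> complex" where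
  "sine k x = complex_of_real (sin (pi * (real k * x)))"

lemma sine_measurable [measurable]: "sine k \<in> borel_measurable borel"
  unfolding sine_def by measurable

lemma norm_sine_le_1: "norm (sine k x) \<le> 1"
  by (simp add: sine_def)

lemma norm_sine_mult_le: "norm (sine k x * z) \<le> norm z"
  using mult_right_mono[OF norm_sine_le_1, of "norm z"] by (simp add: norm_mult)

lemma cnj_sine [simp]: "cnj (sine k x) = sine k x"
  by (simp add: sine_def)

lemma sine_0 [simp]: "sine 0 = 0"
  by (simp add: sine_def fun_eq_iff)

lemma dil_sine: "dil k (sine n) = sine (k * n)"
  by (simp add: dil_def sine_def fun_eq_iff mult_ac)

lemma sine_odd_periodic: "sine k \<in> odd_periodic"
proof -
  have "sine k \<in> square_integrable I01"
    using norm_sine_le_1 by (intro finite_measure.square_integrable_bounded finite_measure_I01) auto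
  moreover have "sine k (x + 2) = sine k x" for x
    using sin.plus_of_nat[of "pi * (real k * x)" k] by (simp add: sine_def algebra_simps)
  ultimately show ?thesis by (simp add: odd_periodic_def) (simp add: sine_def)
qed

lemmas sine_square_integrable = odd_periodic_square_integrable[OF sine_odd_periodic]

lemma l2_inner_sine_sine:
  assumes "j > 0" "k > 0"
  shows "l2_inner I01 (sine j) (sine k) = (if j = k then 1 / 2 else 0)"
proof -
  let ?c = "\<lambda>n x. cos (pi * (of_int n * x))"
  have "sine j x * sine k x = of_real ((?c (int j - int k) x - ?c (int j + int k) x) / 2)" for x
    unfolding sine_def of_real_mult[symmetric] by (simp add: sin_times_sin algebra_simps)
  then have "l2_inner I01 (sine j) (sine k) =
      of_real (LINT x|I01. (?c (int j - int k) x - ?c (int j + int k) x) / 2)"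
    unfolding l2_inner_def by (simp only: cnj_sine integral_complex_of_real)
  also have "\<dots> = (if j = k then 1 / 2 else 0)"
    using assms
    by (simp add: Bochner_Integration.integral_diff integrable_cos_pi_int LINT_cos_pi_int del: of_int_diff of_int_add)
  finally show ?thesis .
qed

definition sine_coeff :: "(real \<Rightarrow> complex) \<Rightarrow> nat \<Rightarrow> complex" where
  "sine_coeff f k = 2 * l2_inner I01 f (sine k)"

definition sine_sum :: "nat set \<Rightarrow> (nat \<Rightarrow> complex) \<Rightarrow> real \<Rightarrow> complex" where
  "sine_sum K a = (\<Sum>k\<in>K. a k *\<^sub>F sine k)"

lemma sine_sum_odd_periodic: "sine_sum K a \<in> odd_periodic"
  unfolding sine_sum_def by (intro odd_periodic_sum odd_periodic_fscale sine_odd_periodic)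

lemmas sine_sum_square_integrable = odd_periodic_square_integrable[OF sine_sum_odd_periodic]

lemma l2_inner_sine_sum:
  assumes "f \<in> square_integrable I01"
  shows "l2_inner I01 f (sine_sum K a) = (\<Sum>k\<in>K. cnj (a k) * sine_coeff f k) / 2"
proof -
  have "l2_inner I01 f (sine_sum K a) = (\<Sum>k\<in>K. l2_inner I01 f (a k *\<^sub>F sine k))"
    unfolding sine_sum_def using assms
    by (intro l2_inner_sum_right square_integrable_fscale sine_square_integrable)
  then show ?thesis
    by (simp add: l2_inner_fscale_right sine_coeff_def sum_divide_distrib)
qed

lemma sine_coeff_sine_sum:
  assumes "finite K" "0 \<notin> K" "k \<in> K"
  shows "sine_coeff (sine_sum K a) k = a k"
proof -
  have pos: "j > 0" if "j \<in> K" for j using that assms(2) by (cases j) auto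
  have "sine_coeff (sine_sum K a) k = cnj (\<Sum>j\<in>K. cnj (a j) * sine_coeff (sine k) j)"
    unfolding sine_coeff_def[of "sine_sum K a"]
    by (subst l2_inner_commute) (simp add: l2_inner_sine_sum sine_square_integrable)
  also have "\<dots> = (\<Sum>j\<in>K. if j = k then a j else 0)"
    unfolding cnj_sum using pos assms(3)
    by (intro sum.cong) (simp_all add: sine_coeff_def l2_inner_sine_sine)
  also have "\<dots> = a k" using assms by simp
  finally show ?thesis .
qed

lemma nrm_sine_sum_square:
  assumes "finite K" "0 \<notin> K"
  shows "(nrm (sine_sum K a))\<^sup>2 = (\<Sum>k\<in>K. (norm (a k))\<^sup>2) / 2"
proof -
  have "complex_of_real ((nrm (sine_sum K a))\<^sup>2) = (\<Sum>k\<in>K. cnj (a k) * a k) / 2"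
    unfolding l2_inner_self[symmetric] using assms
    by (simp add: l2_inner_sine_sum sine_sum_square_integrable sine_coeff_sine_sum)
  also have "\<dots> = complex_of_real ((\<Sum>k\<in>K. (norm (a k))\<^sup>2) / 2)"
    by (simp add: complex_norm_square mult.commute flip: of_real_power)
  finally show ?thesis by (simp only: of_real_eq_iff)
qed

lemma nrm_diff_sine_sum_square:
  assumes f: "f \<in> square_integrable I01" and K: "finite K" "0 \<notin> K"
  shows "(nrm (f - sine_sum K a))\<^sup>2 =
    (nrm f)\<^sup>2 + (\<Sum>k\<in>K. (norm (a k - sine_coeff f k))\<^sup>2 - (norm (sine_coeff f k))\<^sup>2) / 2"
proof -
  have "(norm (b - c))\<^sup>2 - (norm c)\<^sup>2 = (norm b)\<^sup>2 - 2 * Re (cnj b * c)" for b c :: complex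
    using cmod_add_square[of b "- c"] by (simp add: algebra_simps)
  then have "(\<Sum>k\<in>K. (norm (a k - sine_coeff f k))\<^sup>2 - (norm (sine_coeff f k))\<^sup>2) =
      (\<Sum>k\<in>K. (norm (a k))\<^sup>2) - 2 * Re (\<Sum>k\<in>K. cnj (a k) * sine_coeff f k)"
    by (simp only: sum_subtractf sum_distrib_left Re_sum)
  then show ?thesis
    by (simp add: l2_norm_diff_square[OF f sine_sum_square_integrable] l2_inner_sine_sum[OF f]
        nrm_sine_sum_square[OF K] diff_divide_distrib)
qed

section \<open>Density of sine polynomials\<close>

abbreviation sine_polynomials :: "(real \<Rightarrow> complex) set" where
  "sine_polynomials \<equiv> dilation_span (sine 1)"

lemma sine_polynomials_square_integrable: "sine_polynomials \<subseteq> square_integrable I01"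
  using dilation_span_odd_periodic[OF sine_odd_periodic] odd_periodic_square_integrable by blast

lemma sine_in_sine_polynomials: "sine k \<in> sine_polynomials"
proof (cases "k = 0")
  case True
  then show ?thesis by (simp add: dilation_span_def cfun.span_zero)
next
  case False
  then show ?thesis using dil_in_dilation_span[of k "sine 1"] by (simp add: dil_sine)
qed

lemma sine_polynomialsE:
  assumes "f \<in> sine_polynomials"
  obtains N a where "f = sine_sum {1..N} a"
  by (rule dilation_spanE[OF assms], rule that) (simp add: sine_sum_def dil_sine)

lemma sine_mult_cos_in_sine_polynomials: "(\<lambda>x. sine k x * of_real (cos (pi * x))) \<in> sine_polynomials"
proof (cases "k = 0")
  case True
  then show ?thesis using cfun.subspace_0[OF subspace_dilation_span] by (simp add: zero_fun_def)
next
  case False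
  have "sine k x * of_real (cos (pi * x)) = 1 / 2 * (sine (k + 1) x + sine (k - 1) x)" for x
  proof -
    have "sin (pi * (real k * x)) * cos (pi * x) =
        1 / 2 * (sin (pi * (real (k + 1) * x)) + sin (pi * (real (k - 1) * x)))"
      using False sin_add[of "pi * (real k * x)" "pi * x"] sin_diff[of "pi * (real k * x)" "pi * x"]
      by (simp add: of_nat_diff algebra_simps)
    from arg_cong[OF this, of complex_of_real] show ?thesis
      unfolding sine_def of_real_mult of_real_add by simp
  qed
  then have "(\<lambda>x. sine k x * of_real (cos (pi * x))) = (1 / 2) *\<^sub>F (sine (k + 1) + sine (k - 1))"
    by (simp add: fun_eq_iff)
  then show ?thesis
    by (simp only:) (intro dilation_span_fscale dilation_span_add sine_in_sine_polynomials)
qed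

lemma sine_polynomials_mult_cos:
  "sine_polynomials \<subseteq> {f. (\<lambda>x. f x * of_real (cos (pi * x))) \<in> sine_polynomials}"
proof (rule dilation_span_minimal)
  show "cfun.subspace {f. (\<lambda>x. f x * of_real (cos (pi * x))) \<in> sine_polynomials}"
    by (rule cfun.subspaceI)
       (use cfun.subspace_0[OF subspace_dilation_span] dilation_span_add dilation_span_fscale in
         \<open>fastforce simp: zero_fun_def plus_fun_def fscale_def distrib_right mult.assoc\<close>)+
qed (use sine_mult_cos_in_sine_polynomials in \<open>simp add: dil_sine\<close>)

lemma sine_1_mult_polynomial_cos:
  assumes "real_polynomial_function p"
  shows "(\<lambda>x. sine 1 x * of_real (p (cos (pi * x)))) \<in> sine_polynomials"
proof -
  have power: "(\<lambda>x. sine 1 x * of_real (cos (pi * x)) ^ i) \<in> sine_polynomials" for i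
  proof (induction i)
    case 0
    show ?case by (simp only: power_0 mult_1_right sine_in_sine_polynomials)
  next
    case (Suc i)
    with sine_polynomials_mult_cos show ?case by (auto simp only: power_Suc2 mult.assoc)
  qed
  obtain a and n :: nat where "p = (\<lambda>x. \<Sum>i\<le>n. a i * x ^ i)"
    using real_polynomial_function_imp_sum[OF assms] by blast
  then have "(\<lambda>x. sine 1 x * of_real (p (cos (pi * x)))) =
      (\<Sum>i\<le>n. of_real (a i) *\<^sub>F (\<lambda>x. sine 1 x * of_real (cos (pi * x)) ^ i))"
    by (auto simp: fun_eq_iff sum_fun_apply sum_distrib_left mult_ac)
  then show ?thesis
    by (simp only:) (intro cfun.subspace_sum[OF subspace_dilation_span] dilation_span_fscale power)
qed

lemma continuous_on_square_integrable_I01: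
  assumes "continuous_on {0..1} f"
  shows "f \<in> square_integrable I01"
proof -
  have "bounded (f ` {0..1})"
    by (intro compact_imp_bounded compact_continuous_image assms) simp
  then obtain B where "\<forall>x\<in>{0..1}. norm (f x) \<le> B" unfolding bounded_iff by blast
  moreover have "f \<in> borel_measurable (lebesgue_on {0..1})"
    by (rule continuous_imp_measurable_on_sets_lebesgue[OF assms]) auto
  then have "f \<in> borel_measurable I01" by (rule measurable_restrict_mono) auto
  ultimately show ?thesis
    by (intro finite_measure.square_integrable_bounded[OF finite_measure_I01])
       (auto simp: space_restrict_space)
qed

lemma sine_1_mult_continuous_real:
  fixes h :: "real \<Rightarrow> real"
  assumes cont: "continuous_on {0..1} h"
  shows "(\<lambda>x. sine 1 x * of_real (h x)) \<in> l2_closure I01 sine_polynomials"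
proof (rule l2_closureI)
  let ?f = "\<lambda>x. sine 1 x * of_real (h x)"
  show f: "?f \<in> square_integrable I01"
    unfolding sine_def using cont by (intro continuous_on_square_integrable_I01 continuous_intros)
  fix e :: real assume "e > 0"
  have "continuous_on {-1..1} (\<lambda>t. h (arccos t / pi))"
    by (intro continuous_on_compose2[OF cont] continuous_intros) (auto simp: arccos_lbound arccos_ubound)
  then obtain p where p: "real_polynomial_function p"
      "\<And>t. t \<in> {-1..1} \<Longrightarrow> \<bar>h (arccos t / pi) - p t\<bar> < e / 2"
    using Stone_Weierstrass_real_polynomial_function[of "{-1..1}" "\<lambda>t. h (arccos t / pi)" "e / 2"] \<open>e > 0\<close>
    by auto
  let ?s = "\<lambda>x. sine 1 x * of_real (p (cos (pi * x)))"
  have s: "?s \<in> sine_polynomials" by (rule sine_1_mult_polynomial_cos[OF p(1)])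
  have "norm (?f x - ?s x) \<le> e / 2" if "x \<in> {0<..<1}" for x
  proof -
    have "?f x - ?s x = sine 1 x * of_real (h x - p (cos (pi * x)))"
      by (simp add: right_diff_distrib)
    also have "norm \<dots> \<le> norm (complex_of_real (h x - p (cos (pi * x))))"
      by (rule norm_sine_mult_le)
    also have "\<dots> \<le> e / 2"
      using p(2)[of "cos (pi * x)"] that by (simp add: arccos_cos del: of_real_diff)
    finally show ?thesis .
  qed
  moreover have "?f - ?s \<in> borel_measurable I01"
    using f s sine_polynomials_square_integrable
    by (blast intro: square_integrable_measurable square_integrable_diff)
  ultimately have "nrm (?f - ?s) \<le> e / 2 * sqrt (measure I01 (space I01))"
    using \<open>e > 0\<close>
    by (intro finite_measure.l2_norm_le_bounded[OF finite_measure_I01]) (auto simp: space_restrict_space)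
  then show "\<exists>g\<in>sine_polynomials. nrm (?f - g) < e"
    using s \<open>e > 0\<close> by (intro bexI[of _ ?s]) auto
qed

lemma bounded_measurable_AE_limit_continuous:
  fixes h :: "'a::euclidean_space \<Rightarrow> 'b::euclidean_space"
  assumes h: "h \<in> borel_measurable (lebesgue_on S)" and S: "S \<in> sets lebesgue"
    and B: "B \<ge> 0" "\<And>x. x \<in> S \<Longrightarrow> norm (h x) \<le> B"
  obtains g where "\<And>n::nat. continuous_on UNIV (g n)" "\<And>n x. norm (g n x) \<le> B"
    "AE x in lebesgue_on S. (\<lambda>n. g n x) \<longlonglongrightarrow> h x"
proof -
  have "h measurable_on S" using h S by (simp add: measurable_on_iff_borel_measurable)
  then obtain N g where N: "negligible N" and g: "\<And>n. continuous_on UNIV (g n)"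
    and lim: "\<And>x. x \<notin> N \<Longrightarrow> (\<lambda>n. g n x) \<longlonglongrightarrow> (if x \<in> S then h x else 0)"
    unfolding measurable_on_def by blast
  define clip :: "'b \<Rightarrow> 'b" where "clip = closest_point (cball 0 B)"
  have clip: "continuous_on UNIV clip"
    unfolding clip_def using B(1) by (intro continuous_on_closest_point) auto
  show ?thesis
  proof
    show "continuous_on UNIV (\<lambda>x. clip (g n x))" for n
      by (rule continuous_on_compose2[OF clip g]) simp
    show "norm (clip (g n x)) \<le> B" for n x
      using closest_point_in_set[of "cball 0 B" "g n x"] B(1) by (simp add: clip_def)
    have "AE x in lebesgue. x \<notin> N"
      using N by (intro AE_not_in) (simp add: negligible_iff_null_sets)
    then have "AE x in lebesgue_on S. x \<in> S \<and> x \<notin> N"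
      using S by (auto simp: AE_restrict_space_iff elim: eventually_mono)
    then show "AE x in lebesgue_on S. (\<lambda>n. clip (g n x)) \<longlonglongrightarrow> h x"
    proof eventually_elim
      fix x assume x: "x \<in> S \<and> x \<notin> N"
      then have "(\<lambda>n. clip (g n x)) \<longlonglongrightarrow> clip (h x)"
        using lim[of x] by (intro continuous_on_tendsto_compose[OF clip]) auto
      moreover have "clip (h x) = h x"
        using B(2)[of x] x by (simp add: clip_def closest_point_self)
      ultimately show "(\<lambda>n. clip (g n x)) \<longlonglongrightarrow> h x" by simp
    qed
  qed
qed

lemma subspace_closure_sine_polynomials: "cfun.subspace (l2_closure I01 sine_polynomials)"
  by (intro subspace_l2_closure subspace_dilation_span sine_polynomials_square_integrable)

lemma closure_sine_polynomials_sequentially: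
  assumes "f \<in> square_integrable I01" "\<And>n::nat. g n \<in> l2_closure I01 sine_polynomials"
    "(\<lambda>n. nrm (f - g n)) \<longlonglongrightarrow> 0"
  shows "f \<in> l2_closure I01 sine_polynomials"
  using l2_closure_sequentially[OF assms] l2_closure_idem[OF sine_polynomials_square_integrable] by simp

lemma sine_1_mult_continuous:
  fixes h :: "real \<Rightarrow> complex"
  assumes "continuous_on {0..1} h"
  shows "(\<lambda>x. sine 1 x * h x) \<in> l2_closure I01 sine_polynomials"
proof -
  have "(\<lambda>x. sine 1 x * of_real (Re (h x))) + \<i> *\<^sub>F (\<lambda>x. sine 1 x * of_real (Im (h x)))
      \<in> l2_closure I01 sine_polynomials"
    using assms
    by (intro cfun.subspace_add[OF subspace_closure_sine_polynomials] continuous_intros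
        cfun.subspace_scale[OF subspace_closure_sine_polynomials] sine_1_mult_continuous_real)
  moreover have "sine 1 x * h x = sine 1 x * of_real (Re (h x)) + \<i> * (sine 1 x * of_real (Im (h x)))" for x
    by (subst complex_eq) (simp add: algebra_simps)
  ultimately show ?thesis by (simp add: plus_fun_def fscale_def)
qed

lemma sine_1_mult_bounded:
  assumes h [measurable]: "h \<in> borel_measurable I01"
    and B: "B \<ge> 0" "\<And>x. x \<in> {0<..<1} \<Longrightarrow> norm (h x) \<le> B"
  shows "(\<lambda>x. sine 1 x * h x) \<in> l2_closure I01 sine_polynomials"
proof -
  interpret finite_measure I01 by (rule finite_measure_I01)
  obtain g where g: "\<And>n::nat. continuous_on UNIV (g n)" "\<And>n x. norm (g n x) \<le> B"
    "AE x in I01. (\<lambda>n. g n x) \<longlonglongrightarrow> h x"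
    by (rule bounded_measurable_AE_limit_continuous[OF h _ B]) auto
  have [measurable]: "g n \<in> borel_measurable borel" for n
    using g(1) by (rule borel_measurable_continuous_onI)
  have bound: "norm (sine 1 x * h x) \<le> B" if "x \<in> space I01" for x
    using that B(2) by (intro order_trans[OF norm_sine_mult_le]) (simp add: space_restrict_space)
  show ?thesis
  proof (rule closure_sine_polynomials_sequentially)
    show "(\<lambda>x. sine 1 x * h x) \<in> square_integrable I01"
      using bound by (intro square_integrable_bounded[where B = B]) measurable
    show "(\<lambda>x. sine 1 x * g n x) \<in> l2_closure I01 sine_polynomials" for n
      using g(1) by (intro sine_1_mult_continuous) (auto intro: continuous_on_subset)
    show "(\<lambda>n. nrm ((\<lambda>x. sine 1 x * h x) - (\<lambda>x. sine 1 x * g n x))) \<longlonglongrightarrow> 0"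
    proof (rule l2_norm_tendsto_0_dominated)
      show "integrable I01 (\<lambda>x. (B + B)\<^sup>2)" by simp
      show "(norm (sine 1 x * h x - sine 1 x * g n x))\<^sup>2 \<le> (B + B)\<^sup>2" if "x \<in> space I01" for n x
        using bound[OF that] order_trans[OF norm_sine_mult_le g(2)]
        by (intro power_mono order_trans[OF norm_triangle_ineq4] add_mono) auto
      show "AE x in I01. (\<lambda>n. sine 1 x * g n x) \<longlonglongrightarrow> sine 1 x * h x"
        using g(3) by eventually_elim (intro tendsto_intros)
    qed measurable
  qed
qed

text \<open>Approximating $f / \sin(\pi x)$ instead of $f$ makes the continuous approximants vanish at the endpoints.\<close>

theorem sine_polynomials_dense: "square_integrable I01 \<subseteq> l2_closure I01 sine_polynomials"
proof
  fix f assume f: "f \<in> square_integrable I01"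
  have [measurable]: "f \<in> borel_measurable I01" using f by (rule square_integrable_measurable)
  define g where "g n x = (if norm (f x / sine 1 x) \<le> real n then f x / sine 1 x else 0)" for n x
  have [measurable]: "g n \<in> borel_measurable I01" for n
    unfolding g_def by measurable
  have sine_g: "sine 1 x * g n x = (if norm (f x / sine 1 x) \<le> real n then f x else 0)"
    if "x \<in> space I01" for n x
    using that sin_gt_zero[of "pi * x"] by (auto simp: g_def sine_def space_restrict_space)
  show "f \<in> l2_closure I01 sine_polynomials"
  proof (rule closure_sine_polynomials_sequentially[OF f])
    show "(\<lambda>x. sine 1 x * g n x) \<in> l2_closure I01 sine_polynomials" for n
      by (rule sine_1_mult_bounded[where B = "real n"]) (auto simp: g_def)
    show "(\<lambda>n. nrm (f - (\<lambda>x. sine 1 x * g n x))) \<longlonglongrightarrow> 0"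
    proof (rule l2_norm_tendsto_0_dominated)
      show "integrable I01 (\<lambda>x. (norm (f x))\<^sup>2)" using f by (rule square_integrable_integrable)
      show "AE x in I01. (\<lambda>n. sine 1 x * g n x) \<longlonglongrightarrow> f x"
      proof (rule AE_I2)
        fix x assume x: "x \<in> space I01"
        obtain N where "norm (f x / sine 1 x) \<le> real N" using real_arch_simple by blast
        then have "sine 1 x * g n x = f x" if "n \<ge> N" for n
          using that sine_g[OF x] by (simp add: order_trans[of _ "real N"])
        then show "(\<lambda>n. sine 1 x * g n x) \<longlonglongrightarrow> f x"
          by (intro tendsto_eventually) (auto simp: eventually_sequentially)
      qed
      show "(norm (f x - sine 1 x * g n x))\<^sup>2 \<le> (norm (f x))\<^sup>2" if "x \<in> space I01" for n x
        unfolding sine_g[OF that] by simp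
    qed measurable
  qed
qed

section \<open>Sine series\<close>

definition has_sine_series :: "(real \<Rightarrow> complex) \<Rightarrow> (nat \<Rightarrow> complex) \<Rightarrow> bool" where
  "has_sine_series f a \<longleftrightarrow> f \<in> odd_periodic \<and> (\<lambda>N. nrm (f - sine_sum {1..N} a)) \<longlonglongrightarrow> 0"

lemma has_sine_series_odd_periodic: "has_sine_series f a \<Longrightarrow> f \<in> odd_periodic"
  by (simp add: has_sine_series_def)

lemma best_approximation_sine_coeff:
  assumes f: "f \<in> square_integrable I01" and "N \<le> M"
  shows "nrm (f - sine_sum {1..M} (sine_coeff f)) \<le> nrm (f - sine_sum {1..N} b)"
proof (rule power2_le_imp_le)
  let ?c = "sine_coeff f"
  have "(nrm (f - sine_sum {1..M} ?c))\<^sup>2 = (nrm f)\<^sup>2 + (\<Sum>k=1..M. - (norm (?c k))\<^sup>2) / 2"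
    using f by (subst nrm_diff_sine_sum_square) auto
  also have "\<dots> \<le> (nrm f)\<^sup>2 + (\<Sum>k=1..N. - (norm (?c k))\<^sup>2) / 2"
    using assms(2) unfolding sum_negf
    by (intro add_left_mono divide_right_mono le_imp_neg_le sum_mono2) auto
  also have "\<dots> \<le> (nrm f)\<^sup>2 + (\<Sum>k=1..N. (norm (b k - ?c k))\<^sup>2 - (norm (?c k))\<^sup>2) / 2"
    by (intro add_left_mono divide_right_mono sum_mono) auto
  also have "\<dots> = (nrm (f - sine_sum {1..N} b))\<^sup>2"
    using f by (subst nrm_diff_sine_sum_square) auto
  finally show "(nrm (f - sine_sum {1..M} ?c))\<^sup>2 \<le> (nrm (f - sine_sum {1..N} b))\<^sup>2" .
qed simp

lemma has_sine_series_sine_coeff: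
  assumes f: "f \<in> odd_periodic"
  shows "has_sine_series f (sine_coeff f)"
  unfolding has_sine_series_def
proof (intro conjI f LIMSEQ_I)
  fix e :: real assume "e > 0"
  have sq: "f \<in> square_integrable I01" using f by (rule odd_periodic_square_integrable)
  obtain p where "p \<in> sine_polynomials" "nrm (f - p) < e"
    using sine_polynomials_dense sq \<open>e > 0\<close> by (blast elim: l2_closureE)
  moreover from this(1) obtain N b where "p = sine_sum {1..N} b" by (rule sine_polynomialsE)
  ultimately have "nrm (f - sine_sum {1..M} (sine_coeff f)) < e" if "M \<ge> N" for M
    using best_approximation_sine_coeff[OF sq that, of b] by simp
  then show "\<exists>N. \<forall>M\<ge>N. norm (nrm (f - sine_sum {1..M} (sine_coeff f)) - 0) < e" by auto
qed

lemma has_sine_series_sine_1: "has_sine_series (sine 1) (\<lambda>k. if k = 1 then 1 else 0)"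
proof -
  have "sine_sum {1..N} (\<lambda>k. if k = 1 then 1 else 0) = sine 1" if "N \<ge> 1" for N
  proof -
    have "sine_sum {1..N} (\<lambda>k. if k = 1 then 1 else 0) = (\<Sum>k\<in>{1..N}. if k = 1 then sine 1 else 0)"
      unfolding sine_sum_def by (rule sum.cong) auto
    then show ?thesis using that by simp
  qed
  then have "eventually (\<lambda>N. nrm (sine 1 - sine_sum {1..N} (\<lambda>k. if k = 1 then 1 else 0)) = 0) sequentially"
    unfolding eventually_sequentially by (intro exI[of _ 1]) auto
  then show ?thesis
    unfolding has_sine_series_def by (auto intro: sine_odd_periodic tendsto_eventually)
qed

lemma has_sine_series_fscale:
  assumes "has_sine_series f a"
  shows "has_sine_series (c *\<^sub>F f) (\<lambda>k. c * a k)"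
proof -
  have "c *\<^sub>F f - sine_sum {1..N} (\<lambda>k. c * a k) = c *\<^sub>F (f - sine_sum {1..N} a)" for N
    by (simp add: sine_sum_def cfun.scale_right_diff_distrib cfun.scale_sum_right)
  moreover have "(\<lambda>N. norm c * nrm (f - sine_sum {1..N} a)) \<longlonglongrightarrow> 0"
    using assms tendsto_mult_right_zero by (auto simp: has_sine_series_def)
  ultimately show ?thesis
    using assms by (simp only: has_sine_series_def l2_norm_fscale odd_periodic_fscale simp_thms)
qed

lemma has_sine_series_diff:
  assumes f: "has_sine_series f a" and g: "has_sine_series g b"
  shows "has_sine_series (f - g) (\<lambda>k. a k - b k)"
proof -
  let ?F = "\<lambda>N. f - sine_sum {1..N} a" and ?G = "\<lambda>N. g - sine_sum {1..N} b"
  note odd = has_sine_series_odd_periodic[OF f] has_sine_series_odd_periodic[OF g]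
  have sq: "?F N \<in> square_integrable I01" "?G N \<in> square_integrable I01" for N
    using odd by (auto intro!: odd_periodic_square_integrable odd_periodic_diff sine_sum_odd_periodic)
  have eq: "f - g - sine_sum {1..N} (\<lambda>k. a k - b k) = ?F N - ?G N" for N
    by (simp add: sine_sum_def cfun.scale_left_diff_distrib sum_subtractf)
  have "nrm (?F N - ?G N) \<le> nrm (?F N) + nrm (?G N)" for N
    using sq by (rule l2_norm_diff_le)
  moreover have "(\<lambda>N. nrm (?F N) + nrm (?G N)) \<longlonglongrightarrow> 0"
    using f g by (auto simp: has_sine_series_def intro: tendsto_add_zero)
  ultimately have "(\<lambda>N. nrm (?F N - ?G N)) \<longlonglongrightarrow> 0"
    by (rule l2_norm_tendsto_0_comparison)
  then show ?thesis
    using odd by (simp only: has_sine_series_def eq odd_periodic_diff simp_thms)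
qed

lemma multiples_atMost_eq_image:
  fixes p :: nat
  assumes "p > 0"
  shows "{k \<in> {1..N}. p dvd k} = (*) p ` {1..N div p}"
proof (intro equalityI subsetI)
  fix k assume "k \<in> {k \<in> {1..N}. p dvd k}"
  then obtain j where "k = p * j" "1 \<le> k" "p * j \<le> N" by auto
  then have "j \<in> {1..N div p}"
    using assms by (simp add: less_eq_div_iff_mult_less_eq mult.commute Suc_le_eq)
  then show "k \<in> (*) p ` {1..N div p}" using \<open>k = p * j\<close> by blast
next
  fix k assume "k \<in> (*) p ` {1..N div p}"
  then show "k \<in> {k \<in> {1..N}. p dvd k}"
    using assms by (auto simp: less_eq_div_iff_mult_less_eq mult.commute Suc_le_eq)
qed

lemma dil_sine_sum:
  assumes "p > 0"
  shows "dil p (sine_sum {1..N div p} a) = sine_sum {1..N} (\<lambda>k. if p dvd k then a (k div p) else 0)"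
proof -
  have "dil p (sine_sum {1..N div p} a) = (\<Sum>j\<in>{1..N div p}. a j *\<^sub>F sine (p * j))"
    by (simp add: sine_sum_def dil.sum dil.scale dil_sine)
  also have "\<dots> = (\<Sum>k\<in>{k \<in> {1..N}. p dvd k}. a (k div p) *\<^sub>F sine k)"
    unfolding multiples_atMost_eq_image[OF assms] using assms
    by (subst sum.reindex) (auto simp: inj_on_def)
  also have "\<dots> = sine_sum {1..N} (\<lambda>k. if p dvd k then a (k div p) else 0)"
    unfolding sine_sum_def by (intro sum.mono_neutral_cong_left) auto
  finally show ?thesis .
qed

lemma has_sine_series_dil:
  assumes f: "has_sine_series f a" and p: "p > 0"
  shows "has_sine_series (dil p f) (\<lambda>k. if p dvd k then a (k div p) else 0)"
proof -
  have odd: "f \<in> odd_periodic" and lim: "(\<lambda>N. nrm (f - sine_sum {1..N} a)) \<longlonglongrightarrow> 0"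
    using f by (auto simp: has_sine_series_def)
  have "nrm (dil p f - dil p (sine_sum {1..N} a)) = nrm (f - sine_sum {1..N} a)" for N
    using odd p by (simp add: nrm_dil odd_periodic_diff sine_sum_odd_periodic flip: dil.diff)
  moreover have "filterlim (\<lambda>N. N div p) at_top at_top"
    using p by (rule filterlim_at_top_div_const_nat)
  then have "(\<lambda>N. nrm (f - sine_sum {1..N div p} a)) \<longlonglongrightarrow> 0"
    by (rule filterlim_compose[OF lim])
  ultimately show ?thesis
    unfolding has_sine_series_def dil_sine_sum[OF p, symmetric] using odd p by (simp add: odd_periodic_dil)
qed

lemma has_sine_series_nrm_le:
  assumes f: "has_sine_series f a" and "B \<ge> 0"
    and coeffs_le: "\<And>N. (\<Sum>k=1..N. (norm (a k))\<^sup>2) \<le> 2 * B\<^sup>2"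
  shows "nrm f \<le> B"
proof (rule LIMSEQ_le_const)
  have "(\<lambda>N. nrm (f - sine_sum {1..N} a)) \<longlonglongrightarrow> 0"
    using f by (simp add: has_sine_series_def)
  from tendsto_add[OF this tendsto_const]
  show "(\<lambda>N. nrm (f - sine_sum {1..N} a) + B) \<longlonglongrightarrow> B" by simp
  have "nrm f \<le> nrm (f - sine_sum {1..N} a) + B" for N
  proof -
    have "(nrm (sine_sum {1..N} a))\<^sup>2 \<le> B\<^sup>2"
      using coeffs_le[of N] by (subst nrm_sine_sum_square) auto
    then have "nrm (sine_sum {1..N} a) \<le> B" using \<open>B \<ge> 0\<close> by (rule power2_le_imp_le)
    moreover have "nrm (f - sine_sum {1..N} a + sine_sum {1..N} a) \<le>
        nrm (f - sine_sum {1..N} a) + nrm (sine_sum {1..N} a)"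
      using has_sine_series_odd_periodic[OF f]
      by (intro l2_norm_triangle odd_periodic_square_integrable odd_periodic_diff sine_sum_odd_periodic)
    ultimately show ?thesis by simp
  qed
  then show "\<exists>N. \<forall>n\<ge>N. nrm f \<le> nrm (f - sine_sum {1..n} a) + B" by blast
qed

section \<open>Closed dilation-invariant subspaces\<close>

text \<open>Polynomials in the dilations; the number bounds the sum of the absolute values of the coefficients.\<close>

inductive dilation_polynomial :: "((real \<Rightarrow> complex) \<Rightarrow> real \<Rightarrow> complex) \<Rightarrow> real \<Rightarrow> bool" where
  zero: "dilation_polynomial (\<lambda>f. 0) 0"
| ident: "dilation_polynomial (\<lambda>f. f) 1"
| dil: "dilation_polynomial A r \<Longrightarrow> k > 0 \<Longrightarrow> dilation_polynomial (\<lambda>f. dil k (A f)) r"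
| add: "dilation_polynomial A r \<Longrightarrow> dilation_polynomial B s \<Longrightarrow> dilation_polynomial (\<lambda>f. A f + B f) (r + s)"
| fscale: "dilation_polynomial A r \<Longrightarrow> dilation_polynomial (\<lambda>f. c *\<^sub>F A f) (norm c * r)"

lemma dilation_polynomial_sum:
  assumes "\<And>i. i \<in> I \<Longrightarrow> dilation_polynomial (A i) (r i)"
  shows "dilation_polynomial (\<lambda>f. \<Sum>i\<in>I. A i f) (\<Sum>i\<in>I. r i)"
  using assms
  by (induction I rule: infinite_finite_induct)
     (auto intro: dilation_polynomial.zero dilation_polynomial.add)

lemma dilation_polynomial_compose:
  assumes "dilation_polynomial A r" "dilation_polynomial B s"
  shows "dilation_polynomial (\<lambda>f. A (B f)) (r * s)"
  using assms
proof (induction rule: dilation_polynomial.induct)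
  case (add A r A' r')
  then show ?case unfolding distrib_right by (intro dilation_polynomial.add)
next
  case (fscale A r c)
  then show ?case unfolding mult.assoc by (intro dilation_polynomial.fscale)
qed (auto intro: dilation_polynomial.zero dilation_polynomial.dil)

lemma dilation_polynomial_funpow:
  assumes "dilation_polynomial A r"
  shows "dilation_polynomial (A ^^ n) (r ^ n)"
proof (induction n)
  case 0
  show ?case using dilation_polynomial.ident by (simp add: id_def)
next
  case (Suc n)
  from dilation_polynomial_compose[OF assms this] show ?case by (simp add: o_def)
qed

lemma dilation_polynomial_nonneg: "dilation_polynomial A r \<Longrightarrow> r \<ge> 0"
  by (induction rule: dilation_polynomial.induct) auto

lemma dilation_polynomial_odd_periodic:
  assumes "dilation_polynomial A r" "f \<in> odd_periodic"
  shows "A f \<in> odd_periodic"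
  using assms
  by (induction rule: dilation_polynomial.induct)
     (blast intro: cfun.subspace_0[OF subspace_odd_periodic] odd_periodic_dil odd_periodic_add odd_periodic_fscale)+

lemma dilation_polynomial_diff:
  "dilation_polynomial A r \<Longrightarrow> A (f - g) = A f - A g"
  by (induction rule: dilation_polynomial.induct)
     (simp_all only: dil.diff cfun.scale_right_diff_distrib add_diff_add diff_self)

lemma nrm_dilation_polynomial_le:
  assumes "dilation_polynomial A r" "f \<in> odd_periodic"
  shows "nrm (A f) \<le> r * nrm f"
  using assms
proof (induction rule: dilation_polynomial.induct)
  case (dil A r k)
  then show ?case
    by (simp only: nrm_dil[OF dilation_polynomial_odd_periodic[OF dil.hyps(1) dil.prems] dil.hyps(2)])
next
  case (add A r B s)
  have "nrm (A f + B f) \<le> nrm (A f) + nrm (B f)"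
    using add.hyps[THEN dilation_polynomial_odd_periodic, OF add.prems]
    by (intro l2_norm_triangle odd_periodic_square_integrable)
  also have "\<dots> \<le> (r + s) * nrm f" using add.IH add.prems by (simp add: distrib_right)
  finally show ?case .
next
  case (fscale A r c)
  then show ?case by (simp only: l2_norm_fscale mult.assoc mult_left_mono norm_ge_zero)
qed (simp_all only: l2_norm_zero mult_zero_left mult_1 order_refl)

locale closed_invariant_subspace =
  fixes M :: "(real \<Rightarrow> complex) set"
  assumes subspace: "cfun.subspace M" and odd_periodic: "M \<subseteq> odd_periodic"
    and dil: "f \<in> M \<Longrightarrow> k > 0 \<Longrightarrow> dil k f \<in> M"
    and closed: "l2_closure I01 M \<inter> odd_periodic \<subseteq> M"
begin

lemmas zero = cfun.subspace_0[OF subspace]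
  and add = cfun.subspace_add[OF subspace]
  and diff = cfun.subspace_diff[OF subspace]
  and fscale = cfun.subspace_scale[OF subspace]
  and sum = cfun.subspace_sum[OF subspace]

lemma mem_if_eq_on_irrationals:
  assumes "f \<in> M" "g \<in> odd_periodic" "\<And>x. x \<notin> \<rat> \<Longrightarrow> g x = f x"
  shows "g \<in> M"
proof -
  have "nrm (g - f) = 0"
    using AE_I01_irrational assms(3) by (intro l2_norm_eq_0_AE) (auto elim: eventually_mono)
  then have "g \<in> l2_closure I01 M"
    using assms(1,2) by (intro l2_closureI odd_periodic_square_integrable bexI[of _ f]) auto
  then show ?thesis using closed assms(2) by blast
qed

lemma mem_if_tendsto:
  assumes "f \<in> odd_periodic" "\<And>n::nat. g n \<in> M" "(\<lambda>n. nrm (f - g n)) \<longlonglongrightarrow> 0"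
  shows "f \<in> M"
  using l2_closure_sequentially[OF odd_periodic_square_integrable[OF assms(1)] assms(2,3)]
    assms(1) closed by blast

lemma dilation_polynomial_mem: "dilation_polynomial A r \<Longrightarrow> f \<in> M \<Longrightarrow> A f \<in> M"
  by (induction rule: dilation_polynomial.induct) (blast intro: zero dil add fscale)+

lemma neumann_series_mem:
  assumes A: "dilation_polynomial A r" and "r < 1" and f: "f \<in> odd_periodic" and mem: "f - A f \<in> M"
  shows "f \<in> M"
proof (rule mem_if_tendsto[OF f])
  note power = dilation_polynomial_funpow[OF A]
  show "f - (A ^^ n) f \<in> M" for n
  proof (induction n)
    case 0
    show ?case using zero by (simp only: funpow_0 diff_self)
  next
    case (Suc n)
    have "(A ^^ n) (f - A f) \<in> M" by (rule dilation_polynomial_mem[OF power mem])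
    then have "(A ^^ n) f - (A ^^ Suc n) f \<in> M"
      by (simp only: dilation_polynomial_diff[OF power] funpow_Suc_right o_apply)
    from add[OF Suc this] show ?case by (simp only: diff_add_cancel add_diff_eq)
  qed
  have "(\<lambda>n. r ^ n * nrm f) \<longlonglongrightarrow> 0"
    using \<open>r < 1\<close> dilation_polynomial_nonneg[OF A] by (intro tendsto_mult_left_zero LIMSEQ_realpow_zero)
  with nrm_dilation_polynomial_le[OF power f] have "(\<lambda>n. nrm ((A ^^ n) f)) \<longlonglongrightarrow> 0"
    by (rule l2_norm_tendsto_0_comparison)
  then show "(\<lambda>n. nrm (f - (f - (A ^^ n) f))) \<longlonglongrightarrow> 0" by simp
qed

end

lemma nrm_sum_sine_inj_square:
  assumes "finite I" and inj: "inj_on \<kappa> I" and pos: "\<And>i. i \<in> I \<Longrightarrow> \<kappa> i > 0"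
  shows "(nrm (\<Sum>i\<in>I. b i *\<^sub>F sine (\<kappa> i)))\<^sup>2 = (\<Sum>i\<in>I. (norm (b i))\<^sup>2) / 2"
proof -
  define c where "c = b \<circ> the_inv_into I \<kappa>"
  have c: "c (\<kappa> i) = b i" if "i \<in> I" for i
    using the_inv_into_f_f[OF inj that] by (simp add: c_def)
  have "(\<Sum>i\<in>I. b i *\<^sub>F sine (\<kappa> i)) = sine_sum (\<kappa> ` I) c"
    unfolding sine_sum_def by (simp add: sum.reindex[OF inj] c)
  moreover have "0 \<notin> \<kappa> ` I" using pos by fastforce
  ultimately show ?thesis
    using assms(1) by (simp add: nrm_sine_sum_square sum.reindex[OF inj] c)
qed

definition cesaro_mean :: "complex \<Rightarrow> nat \<Rightarrow> nat \<Rightarrow> (real \<Rightarrow> complex) \<Rightarrow> real \<Rightarrow> complex" where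
  "cesaro_mean c p N f = (1 / of_nat N) *\<^sub>F (\<Sum>n<N. c ^ n *\<^sub>F dil (p ^ n) f)"

global_interpretation cesaro_mean: Vector_Spaces.linear fscale fscale "cesaro_mean c p N" for c p N
  by unfold_locales
     (simp_all add: cesaro_mean_def dil.add dil.scale cfun.scale_right_distrib sum.distrib
       cfun.scale_sum_right mult.commute mult.left_commute)

context
  fixes c :: complex and p :: nat
  assumes norm_c: "norm c \<le> 1" and p_ge_2: "p \<ge> 2"
begin

lemma cesaro_mean_odd_periodic: "f \<in> odd_periodic \<Longrightarrow> cesaro_mean c p N f \<in> odd_periodic"
  unfolding cesaro_mean_def using p_ge_2
  by (intro odd_periodic_fscale odd_periodic_sum odd_periodic_dil) auto

lemma nrm_cesaro_mean_le:
  assumes f: "f \<in> odd_periodic"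
  shows "nrm (cesaro_mean c p N f) \<le> nrm f"
proof -
  have "nrm (\<Sum>n<N. c ^ n *\<^sub>F dil (p ^ n) f) \<le> (\<Sum>n<N. nrm (c ^ n *\<^sub>F dil (p ^ n) f))"
    using f p_ge_2 by (intro l2_norm_sum_le odd_periodic_square_integrable odd_periodic_fscale odd_periodic_dil) auto
  also have "\<dots> \<le> (\<Sum>n<N. nrm f)"
    using f p_ge_2 norm_c
    by (intro sum_mono) (simp add: l2_norm_fscale nrm_dil norm_power power_le_one mult_left_le_one_le)
  finally show ?thesis
    by (cases "N = 0") (simp_all add: cesaro_mean_def l2_norm_fscale norm_divide field_simps)
qed

lemma cesaro_mean_sine_tendsto_0: "(\<lambda>N. nrm (cesaro_mean c p N (sine k))) \<longlonglongrightarrow> 0"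
proof (cases "k = 0")
  case False
  have "nrm (cesaro_mean c p N (sine k)) \<le> sqrt (1 / real N)" for N
  proof (cases "N = 0")
    case False
    have inj: "inj_on (\<lambda>n. p ^ n * k) {..<N}" using p_ge_2 \<open>k \<noteq> 0\<close> by (auto simp: inj_on_def)
    have "(nrm (\<Sum>n<N. c ^ n *\<^sub>F sine (p ^ n * k)))\<^sup>2 = (\<Sum>n<N. (norm (c ^ n))\<^sup>2) / 2"
      using p_ge_2 \<open>k \<noteq> 0\<close> by (intro nrm_sum_sine_inj_square[OF _ inj]) auto
    also have "\<dots> \<le> (\<Sum>n<N. 1) / 2"
      using norm_c by (intro divide_right_mono sum_mono) (simp_all add: norm_power power_le_one)
    also have "\<dots> \<le> real N" by simp
    finally have "(nrm (cesaro_mean c p N (sine k)))\<^sup>2 \<le> (1 / real N)\<^sup>2 * real N"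
      by (simp add: cesaro_mean_def dil_sine l2_norm_fscale norm_divide power_divide divide_right_mono)
    also have "\<dots> = 1 / real N" using False by (simp add: power2_eq_square)
    finally show ?thesis by (rule real_le_rsqrt)
  qed (simp add: cesaro_mean_def)
  moreover have "(\<lambda>N. sqrt (1 / real N)) \<longlonglongrightarrow> sqrt 0"
    by (intro tendsto_real_sqrt lim_1_over_n)
  ultimately show ?thesis by (intro l2_norm_tendsto_0_comparison) simp_all
qed simp

lemma cesaro_mean_sine_polynomials_tendsto_0:
  "sine_polynomials \<subseteq> {f \<in> odd_periodic. (\<lambda>N. nrm (cesaro_mean c p N f)) \<longlonglongrightarrow> 0}"
proof (rule dilation_span_minimal)
  show "cfun.subspace {f \<in> odd_periodic. (\<lambda>N. nrm (cesaro_mean c p N f)) \<longlonglongrightarrow> 0}" (is "cfun.subspace ?Z")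
  proof (rule cfun.subspaceI)
    show "0 \<in> ?Z" using cfun.subspace_0[OF subspace_odd_periodic] by simp
  next
    fix f g assume fg: "f \<in> ?Z" "g \<in> ?Z"
    then have "(\<lambda>N. nrm (cesaro_mean c p N f) + nrm (cesaro_mean c p N g)) \<longlonglongrightarrow> 0"
      by (auto intro: tendsto_add_zero)
    moreover have "nrm (cesaro_mean c p N (f + g)) \<le> nrm (cesaro_mean c p N f) + nrm (cesaro_mean c p N g)" for N
      unfolding cesaro_mean.add using fg
      by (intro l2_norm_triangle odd_periodic_square_integrable cesaro_mean_odd_periodic) auto
    ultimately have "(\<lambda>N. nrm (cesaro_mean c p N (f + g))) \<longlonglongrightarrow> 0"
      by (rule l2_norm_tendsto_0_comparison[rotated])
    then show "f + g \<in> ?Z" using fg odd_periodic_add by blast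
  next
    fix b f assume "f \<in> ?Z"
    then show "b *\<^sub>F f \<in> ?Z"
      by (auto simp: cesaro_mean.scale l2_norm_fscale odd_periodic_fscale intro: tendsto_mult_right_zero)
  qed
qed (simp add: dil_sine sine_odd_periodic cesaro_mean_sine_tendsto_0)

lemma cesaro_mean_tendsto_0:
  assumes f: "f \<in> odd_periodic"
  shows "(\<lambda>N. nrm (cesaro_mean c p N f)) \<longlonglongrightarrow> 0"
proof (rule LIMSEQ_I)
  fix e :: real assume "e > 0"
  then have half: "e / 2 > 0" by simp
  have "f \<in> l2_closure I01 sine_polynomials"
    using f sine_polynomials_dense odd_periodic_square_integrable by blast
  then obtain s where s: "s \<in> sine_polynomials" "nrm (f - s) < e / 2" using half by (rule l2_closureE)
  then have s_odd: "s \<in> odd_periodic" and lim: "(\<lambda>N. nrm (cesaro_mean c p N s)) \<longlonglongrightarrow> 0"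
    using cesaro_mean_sine_polynomials_tendsto_0 by blast+
  obtain N0 where N0: "\<And>N. N \<ge> N0 \<Longrightarrow> nrm (cesaro_mean c p N s) < e / 2"
    using LIMSEQ_D[OF lim half] by auto
  have "nrm (cesaro_mean c p N f) < e" if "N \<ge> N0" for N
  proof -
    have fs: "f - s \<in> odd_periodic" using f s_odd by (rule odd_periodic_diff)
    have "nrm (cesaro_mean c p N (f - s) + cesaro_mean c p N s) \<le>
        nrm (cesaro_mean c p N (f - s)) + nrm (cesaro_mean c p N s)"
      using fs s_odd by (intro l2_norm_triangle odd_periodic_square_integrable cesaro_mean_odd_periodic)
    then show ?thesis
      using nrm_cesaro_mean_le[OF fs, of N] s(2) N0[OF that] by (simp add: cesaro_mean.diff)
  qed
  then show "\<exists>N0. \<forall>N\<ge>N0. norm (nrm (cesaro_mean c p N f) - 0) < e" by auto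
qed

end

context closed_invariant_subspace
begin

lemma mem_if_diff_dil_mem:
  assumes norm_c: "norm c \<le> 1" and p_ge_2: "p \<ge> 2" and f: "f \<in> odd_periodic"
    and mem: "f - c *\<^sub>F dil p f \<in> M"
  shows "f \<in> M"
proof (rule mem_if_tendsto[OF f])
  have step: "f - c ^ n *\<^sub>F dil (p ^ n) f \<in> M" for n
  proof (induction n)
    case 0
    show ?case using zero by (simp only: power_0 cfun.scale_one dil_1[unfolded One_nat_def[symmetric]] diff_self)
  next
    case (Suc n)
    have "c ^ n *\<^sub>F dil (p ^ n) (f - c *\<^sub>F dil p f) \<in> M"
      using p_ge_2 by (intro fscale dil mem) auto
    then have "c ^ n *\<^sub>F dil (p ^ n) f - c ^ Suc n *\<^sub>F dil (p ^ Suc n) f \<in> M"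
      by (simp add: dil.diff dil.scale dil_dil cfun.scale_right_diff_distrib mult.commute)
    from add[OF Suc this] show ?case by (simp only: diff_add_cancel add_diff_eq)
  qed
  show "f - cesaro_mean c p (Suc N) f \<in> M" for N
  proof -
    have "(1 / of_nat (Suc N)) *\<^sub>F (\<Sum>n<Suc N. f - c ^ n *\<^sub>F dil (p ^ n) f) \<in> M"
      by (intro fscale sum step)
    moreover have "(1 / of_nat (Suc N)) *\<^sub>F (\<Sum>n<Suc N. f) = f"
      by (simp add: fun_eq_iff sum_fun_apply del: of_nat_Suc sum.lessThan_Suc)
    ultimately show ?thesis
      by (simp only: sum_subtractf cfun.scale_right_diff_distrib cesaro_mean_def)
  qed
  show "(\<lambda>N. nrm (f - (f - cesaro_mean c p (Suc N) f))) \<longlonglongrightarrow> 0"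
    using LIMSEQ_Suc[OF cesaro_mean_tendsto_0[OF norm_c p_ge_2 f]] by simp
qed

lemma sieve:
  assumes F: "has_sine_series F a" "F \<in> M" and mult: "\<And>m n. a (m * n) = a m * a n"
    and A: "finite A" "\<And>p. p \<in> A \<Longrightarrow> prime (p::nat)"
  shows "\<exists>g\<in>M. has_sine_series g (\<lambda>k. if \<exists>p\<in>A. p dvd k then 0 else a k)"
  using A
proof (induction A rule: finite_induct)
  case empty
  then show ?case using F by auto
next
  case (insert p A)
  let ?a = "\<lambda>A k. if \<exists>p\<in>A. p dvd k then 0 else a k"
  obtain g where g: "g \<in> M" "has_sine_series g (?a A)" using insert by auto
  have p: "prime p" using insert by simp
  then have "p > 0" by (rule prime_gt_0_nat)
  have "has_sine_series (g - a p *\<^sub>F dil p g) (\<lambda>k. ?a A k - a p * (if p dvd k then ?a A (k div p) else 0))"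
    using g(2) \<open>p > 0\<close> by (intro has_sine_series_diff has_sine_series_fscale has_sine_series_dil)
  moreover have "(\<lambda>k. ?a A k - a p * (if p dvd k then ?a A (k div p) else 0)) = ?a (insert p A)"
  proof
    fix k
    show "?a A k - a p * (if p dvd k then ?a A (k div p) else 0) = ?a (insert p A) k"
    proof (cases "p dvd k")
      case True
      then obtain j where k: "k = p * j" by blast
      have "q dvd k \<longleftrightarrow> q dvd j" if "q \<in> A" for q
        using that insert p k by (metis insertCI prime_dvd_mult_iff primes_dvd_imp_eq)
      then show ?thesis using \<open>p > 0\<close> k by (simp add: mult)
    qed simp
  qed
  ultimately have "has_sine_series (g - a p *\<^sub>F dil p g) (?a (insert p A))" by (simp only:)
  moreover have "g - a p *\<^sub>F dil p g \<in> M" using g(1) \<open>p > 0\<close> by (intro diff fscale dil)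
  ultimately show ?case by (rule bexI)
qed

end

lemma sum_inverse_squares_tail_le:
  assumes "P > 0"
  shows "(\<Sum>k\<in>{P<..N}. 1 / (real k)\<^sup>2) \<le> 1 / real P"
proof (cases "P \<le> N")
  case True
  then have "(\<Sum>k\<in>{P<..N}. 1 / (real k)\<^sup>2) \<le> 1 / real P - 1 / real N"
  proof (induction N rule: dec_induct)
    case (step n)
    have "1 / (real (Suc n))\<^sup>2 \<le> 1 / (real n * real (Suc n))"
      using assms step.hyps by (intro divide_left_mono) (auto simp: power2_eq_square)
    also have "\<dots> = 1 / real n - 1 / real (Suc n)"
      using assms step.hyps by (simp add: field_simps)
    finally have "1 / (real (Suc n))\<^sup>2 \<le> 1 / real n - 1 / real (Suc n)" .
    moreover have "{P<..Suc n} = insert (Suc n) {P<..n}" using step.hyps by auto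
    ultimately show ?case using step.IH by simp
  qed simp
  then show ?thesis by (rule order_trans) simp
qed simp

lemma nrm_sine_1_diff_le:
  assumes g: "has_sine_series g b" and "P > 0" and "b 1 = 1"
    and vanishing: "\<And>k. 1 < k \<Longrightarrow> k \<le> P \<Longrightarrow> b k = 0" and decay: "\<And>k. P < k \<Longrightarrow> norm (b k) \<le> 1 / real k"
  shows "nrm (sine 1 - g) \<le> sqrt (1 / real P)"
proof (rule has_sine_series_nrm_le)
  let ?b = "\<lambda>k. (if k = 1 then 1 else 0) - b k"
  show "has_sine_series (sine 1 - g) ?b"
    by (rule has_sine_series_diff[OF has_sine_series_sine_1 g])
  fix N
  have "\<forall>k\<in>{1..N} - {P<..N}. (norm (?b k))\<^sup>2 = 0"
    using \<open>b 1 = 1\<close> vanishing by auto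
  then have "(\<Sum>k=1..N. (norm (?b k))\<^sup>2) = (\<Sum>k\<in>{P<..N}. (norm (?b k))\<^sup>2)"
    by (rule sum.mono_neutral_right[rotated 2]) auto
  also have "\<dots> \<le> (\<Sum>k\<in>{P<..N}. (1 / real k)\<^sup>2)"
    using decay \<open>P > 0\<close> by (intro sum_mono power_mono) auto
  also have "\<dots> \<le> 1 / real P"
    using sum_inverse_squares_tail_le[OF \<open>P > 0\<close>] by (simp add: power_divide)
  finally have "(\<Sum>k=1..N. (norm (?b k))\<^sup>2) \<le> 1 / real P" .
  then show "(\<Sum>k=1..N. (norm (?b k))\<^sup>2) \<le> 2 * (sqrt (1 / real P))\<^sup>2"
    by (simp add: order_trans[OF _ divide_right_mono])
qed simp

context closed_invariant_subspace
begin

lemma sine_1_approximation: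
  assumes F: "has_sine_series F a" "F \<in> M" and mult: "\<And>m n. a (m * n) = a m * a n"
    and "a 1 = 1" and decay: "\<And>k. k > 0 \<Longrightarrow> norm (a k) \<le> 1 / real k" and "P > 0"
  shows "\<exists>g\<in>M. nrm (sine 1 - g) \<le> sqrt (1 / real P)"
proof -
  let ?A = "{p. prime p \<and> p \<le> P}"
  have "finite ?A" by (rule finite_subset[of _ "{..P}"]) auto
  then obtain g where "g \<in> M" and g: "has_sine_series g (\<lambda>k. if \<exists>p\<in>?A. p dvd k then 0 else a k)"
    using sieve[OF F mult, of ?A] by blast
  have "nrm (sine 1 - g) \<le> sqrt (1 / real P)"
  proof (rule nrm_sine_1_diff_le[OF g \<open>P > 0\<close>])
    show "(if \<exists>p\<in>?A. p dvd 1 then 0 else a 1) = 1"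
      using \<open>a 1 = 1\<close> by auto
    show "(if \<exists>p\<in>?A. p dvd k then 0 else a k) = 0" if "1 < k" "k \<le> P" for k
    proof -
      obtain p where "prime p" "p dvd k" using \<open>1 < k\<close> prime_factor_nat[of k] by auto
      then have "p \<in> ?A" using that dvd_imp_le[of p k] by auto
      then show ?thesis using \<open>p dvd k\<close> by auto
    qed
    show "norm (if \<exists>p\<in>?A. p dvd k then 0 else a k) \<le> 1 / real k" if "P < k" for k
      using decay[of k] that by simp
  qed
  then show ?thesis using \<open>g \<in> M\<close> by blast
qed

lemma sine_1_mem:
  assumes F: "has_sine_series F (\<lambda>k. C * a k)" "F \<in> M" and "C \<noteq> 0"
    and mult: "\<And>m n. a (m * n) = a m * a n"
    and "a 1 = 1" and decay: "\<And>k. k > 0 \<Longrightarrow> norm (a k) \<le> 1 / real k"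
  shows "sine 1 \<in> M"
proof -
  have "has_sine_series ((1 / C) *\<^sub>F F) a"
    using has_sine_series_fscale[OF F(1), of "1 / C"] \<open>C \<noteq> 0\<close> by simp
  then have "\<exists>g\<in>M. nrm (sine 1 - g) \<le> sqrt (1 / real (Suc n))" for n
    using fscale[OF F(2)] by (intro sine_1_approximation[OF _ _ mult \<open>a 1 = 1\<close> decay]) auto
  then obtain g where g: "\<And>n. g n \<in> M" "\<And>n. nrm (sine 1 - g n) \<le> sqrt (1 / real (Suc n))"
    by metis
  have "(\<lambda>n. sqrt (1 / real (Suc n))) \<longlonglongrightarrow> sqrt 0"
    by (intro tendsto_real_sqrt LIMSEQ_Suc lim_1_over_n)
  then have "(\<lambda>n. nrm (sine 1 - g n)) \<longlonglongrightarrow> 0"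
    by (intro l2_norm_tendsto_0_comparison[OF g(2)]) simp
  then show ?thesis by (rule mem_if_tendsto[OF sine_odd_periodic g(1)])
qed

end

lemma closed_invariant_subspace_closure_dilation_span:
  assumes \<phi>: "\<phi> \<in> odd_periodic"
  shows "closed_invariant_subspace (l2_closure I01 (dilation_span \<phi>) \<inter> odd_periodic)"
proof
  let ?D = "dilation_span \<phi>"
  have D_odd: "?D \<subseteq> odd_periodic" by (rule dilation_span_odd_periodic[OF \<phi>])
  then have D: "?D \<subseteq> square_integrable I01" using odd_periodic_square_integrable by blast
  show "cfun.subspace (l2_closure I01 ?D \<inter> odd_periodic)"
    by (intro cfun.subspace_inter subspace_l2_closure subspace_dilation_span subspace_odd_periodic D)
  have "l2_closure I01 (l2_closure I01 ?D \<inter> odd_periodic) \<subseteq> l2_closure I01 (l2_closure I01 ?D)"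
    by (rule l2_closure_mono) simp
  then show "l2_closure I01 (l2_closure I01 ?D \<inter> odd_periodic) \<inter> odd_periodic \<subseteq> l2_closure I01 ?D \<inter> odd_periodic"
    unfolding l2_closure_idem[OF D] by blast
  fix f and k :: nat assume f: "f \<in> l2_closure I01 ?D \<inter> odd_periodic" and k: "k > 0"
  have "dil k f \<in> l2_closure I01 ?D"
  proof (rule l2_closureI)
    show "dil k f \<in> square_integrable I01"
      using f k by (intro odd_periodic_square_integrable odd_periodic_dil) auto
    fix e :: real assume "e > 0"
    with f obtain g where g: "g \<in> ?D" "nrm (f - g) < e" by (blast elim: l2_closureE)
    then have "nrm (dil k f - dil k g) < e"
      using f k D_odd by (simp add: nrm_dil odd_periodic_diff subsetD flip: dil.diff)
    then show "\<exists>h\<in>?D. nrm (dil k f - h) < e" using dil_dilation_span[OF g(1) k] by blast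
  qed
  then show "dil k f \<in> l2_closure I01 ?D \<inter> odd_periodic" using f k odd_periodic_dil by blast
qed simp

lemma cyclic_C_if_dense:
  assumes "\<phi> \<in> square_integrable I01" "square_integrable I01 \<subseteq> l2_closure I01 (dilation_span (odd_ext \<phi>))"
  shows "cyclic_C \<phi>"
  unfolding cyclic_C_def L2_01_eq
proof (intro conjI ballI allI impI assms(1))
  fix g :: "real \<Rightarrow> complex" and \<epsilon> :: real
  assume "g \<in> square_integrable I01" and "\<epsilon> > 0"
  then have "g \<in> l2_closure I01 (dilation_span (odd_ext \<phi>))" "sqrt \<epsilon> > 0" using assms(2) by auto
  then obtain h where h: "h \<in> dilation_span (odd_ext \<phi>)" "nrm (g - h) < sqrt \<epsilon>"
    by (rule l2_closureE)
  obtain N a where "h = (\<Sum>k=1..N. a k *\<^sub>F dil k (odd_ext \<phi>))" using h(1) by (rule dilation_spanE)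
  moreover have "(LINT x|I01. (norm ((g - h) x))\<^sup>2) < \<epsilon>"
    using h(2) by (simp add: l2_norm_def)
  ultimately have "(LINT x|I01. (norm (g x - (\<Sum>k=1..N. a k * odd_ext \<phi> (real k * x))))\<^sup>2) < \<epsilon>"
    by (simp add: sum_fun_apply dil_def)
  then show "\<exists>N a. (LINT x|I01. (norm (g x - (\<Sum>k=1..N. a k * odd_ext \<phi> (real k * x))))\<^sup>2) < \<epsilon>"
    by blast
qed

theorem cyclic_C_if_sine_1_mem:
  assumes \<phi>: "\<phi> \<in> borel_measurable borel" "\<phi> \<in> square_integrable I01"
    and sine: "\<And>M. closed_invariant_subspace M \<Longrightarrow> odd_ext \<phi> \<in> M \<Longrightarrow> sine 1 \<in> M"
  shows "cyclic_C \<phi>"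
proof (rule cyclic_C_if_dense[OF \<phi>(2)])
  let ?D = "dilation_span (odd_ext \<phi>)"
  have \<phi>_odd: "odd_ext \<phi> \<in> odd_periodic" using \<phi> by (rule odd_periodic_odd_ext)
  then have D: "?D \<subseteq> square_integrable I01"
    using dilation_span_odd_periodic odd_periodic_square_integrable by blast
  interpret closed_invariant_subspace "l2_closure I01 ?D \<inter> odd_periodic"
    using \<phi>_odd by (rule closed_invariant_subspace_closure_dilation_span)
  have "odd_ext \<phi> \<in> ?D" using dil_in_dilation_span[of 1 "odd_ext \<phi>"] by simp
  then have "sine 1 \<in> l2_closure I01 ?D \<inter> odd_periodic"
    using subset_l2_closure[OF D] \<phi>_odd by (intro sine[OF closed_invariant_subspace_axioms]) blast
  then have "sine_polynomials \<subseteq> l2_closure I01 ?D \<inter> odd_periodic"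
    by (intro dilation_span_minimal subspace dil)
  then have "l2_closure I01 sine_polynomials \<subseteq> l2_closure I01 (l2_closure I01 ?D)"
    by (intro l2_closure_mono) blast
  then show "square_integrable I01 \<subseteq> l2_closure I01 ?D"
    using sine_polynomials_dense unfolding l2_closure_idem[OF D] by (rule order_trans[rotated])
qed

section \<open>Finite Fourier transforms\<close>

lemma sum_residues_mult:
  fixes f :: "nat \<Rightarrow> 'a::comm_monoid_add"
  assumes "coprime a q" "q > 0" and cong: "\<And>m n. [m = n] (mod q) \<Longrightarrow> f m = f n"
  shows "(\<Sum>m<q. f (a * m)) = (\<Sum>m<q. f m)"
proof -
  have inj: "inj_on (\<lambda>m. a * m mod q) {..<q}"
  proof (rule inj_onI)
    fix x y assume xy: "x \<in> {..<q}" "y \<in> {..<q}" "a * x mod q = a * y mod q"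
    then have "[x = y] (mod q)" using assms(1) cong_mult_lcancel_nat by (simp add: cong_def)
    then show "x = y" using xy by (simp add: cong_def)
  qed
  then have image: "(\<lambda>m. a * m mod q) ` {..<q} = {..<q}"
    using \<open>q > 0\<close> by (intro endo_inj_surj) auto
  have "(\<Sum>m<q. f (a * m)) = (\<Sum>m<q. f (a * m mod q))"
    by (intro sum.cong refl cong) (simp add: cong_def)
  also have "\<dots> = (\<Sum>m<q. f m)"
    using sum.reindex[OF inj, of f] by (simp add: image o_def)
  finally show ?thesis .
qed

lemma sum_lessThan_Suc_periodic:
  fixes h :: "nat \<Rightarrow> 'a::ab_group_add"
  assumes "h N = h 0"
  shows "(\<Sum>m<N. h (Suc m)) = (\<Sum>m<N. h m)"
  using sum.lessThan_Suc_shift[of h N] assms by (simp add: add.commute)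

lemma sum_lessThan_reflect:
  fixes h :: "nat \<Rightarrow> 'a::ab_group_add"
  assumes "h N = h 0"
  shows "(\<Sum>m<N. h (N - m)) = (\<Sum>m<N. h m)"
proof -
  have "(\<Sum>m<N. h (N - m)) = (\<Sum>m<N. h (Suc (N - Suc m)))"
    by (intro sum.cong refl arg_cong[where f = h]) auto
  also have "\<dots> = (\<Sum>m<N. h m)"
    by (simp only: sum.nat_diff_reindex[of "\<lambda>m. h (Suc m)"] sum_lessThan_Suc_periodic[OF assms])
  finally show ?thesis .
qed

definition unit_root :: "nat \<Rightarrow> int \<Rightarrow> complex" where
  "unit_root q j = cis (2 * pi * of_int j / of_nat q)"

lemma unit_root_0 [simp]: "unit_root q 0 = 1"
  by (simp add: unit_root_def)

lemma unit_root_add: "unit_root q (i + j) = unit_root q i * unit_root q j"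
  by (simp add: unit_root_def cis_mult add_divide_distrib distrib_left)

lemma unit_root_power: "unit_root q (int k * j) = unit_root q j ^ k"
  by (induction k) (simp_all add: distrib_right unit_root_add)

lemma unit_root_eq_1_iff:
  assumes "q > 0"
  shows "unit_root q j = 1 \<longleftrightarrow> int q dvd j"
proof -
  have "unit_root q j = 1 \<longleftrightarrow> cos (2 * pi * of_int j / of_nat q) = 1"
    by (auto simp: unit_root_def complex_eq_iff cos_one_sin_zero)
  also have "\<dots> \<longleftrightarrow> (\<exists>n::int. 2 * pi * of_int j / of_nat q = of_int n * 2 * pi)"
    by (rule cos_one_2pi_int)
  also have "\<dots> \<longleftrightarrow> (\<exists>n::int. real_of_int j = of_int (int q * n))"
    using assms by (simp add: field_simps)
  also have "\<dots> \<longleftrightarrow> int q dvd j" by (simp only: of_int_eq_iff dvd_def)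
  finally show ?thesis .
qed

lemma unit_root_cong:
  assumes "q > 0" "[i = j] (mod int q)"
  shows "unit_root q i = unit_root q j"
proof -
  have "unit_root q (i - j) = 1"
    using assms by (simp add: unit_root_eq_1_iff cong_iff_dvd_diff)
  then show ?thesis using unit_root_add[of q "i - j" j] by simp
qed

lemma sum_unit_root:
  assumes "q > 0"
  shows "(\<Sum>k<q. unit_root q (int k * j)) = (if int q dvd j then of_nat q else 0)"
proof (cases "int q dvd j")
  case True
  then have "unit_root q j = 1" using assms by (simp add: unit_root_eq_1_iff)
  then show ?thesis using True by (simp add: unit_root_power)
next
  case False
  moreover have "unit_root q j ^ q = 1"
    using assms by (simp add: unit_root_eq_1_iff flip: unit_root_power)
  ultimately show ?thesis
    using assms by (simp add: unit_root_power geometric_sum unit_root_eq_1_iff)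
qed

definition dft :: "nat \<Rightarrow> (nat \<Rightarrow> complex) \<Rightarrow> nat \<Rightarrow> complex" where
  "dft q f k = (\<Sum>m<q. f m * unit_root q (int k * int m))"

lemma dft_cong: "[k = l] (mod q) \<Longrightarrow> q > 0 \<Longrightarrow> dft q f k = dft q f l"
  unfolding dft_def
  by (intro sum.cong refl arg_cong2[where f = "(*)"] unit_root_cong cong_mult cong_refl)
     (simp_all add: cong_int_iff)

lemma dft_inversion:
  assumes "n < q"
  shows "(\<Sum>k<q. dft q f k * unit_root q (int k * - int n)) = of_nat q * f n"
proof -
  have "(\<Sum>k<q. dft q f k * unit_root q (int k * - int n)) =
      (\<Sum>k<q. \<Sum>m<q. f m * unit_root q (int k * (int m - int n)))"
    unfolding dft_def sum_distrib_right
    by (intro sum.cong refl) (simp add: mult.assoc right_diff_distrib flip: unit_root_add)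
  also have "\<dots> = (\<Sum>m<q. f m * (\<Sum>k<q. unit_root q (int k * (int m - int n))))"
    by (subst sum.swap) (simp add: sum_distrib_left)
  also have "\<dots> = (\<Sum>m<q. if m = n then of_nat q * f m else 0)"
  proof (rule sum.cong[OF refl])
    fix m assume m: "m \<in> {..<q}"
    have "int q dvd int m - int n \<longleftrightarrow> [m = n] (mod q)"
      by (simp only: cong_int_iff flip: cong_iff_dvd_diff)
    also have "\<dots> \<longleftrightarrow> m = n" using m assms by (auto simp: cong_def)
    finally show "f m * (\<Sum>k<q. unit_root q (int k * (int m - int n))) = (if m = n then of_nat q * f m else 0)"
      using assms by (simp add: sum_unit_root)
  qed
  also have "\<dots> = of_nat q * f n" using assms by simp
  finally show ?thesis .
qed

lemma dft_even:
  assumes "q > 0" "f q = f 0" and even: "\<And>m. m < q \<Longrightarrow> f (q - m) = f m"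
  shows "dft q f k = (\<Sum>m<q. f m * of_real (cos (2 * pi * real k * real m / real q)))"
proof -
  let ?e = "\<lambda>m. unit_root q (int k * int m)" and ?e' = "\<lambda>m. unit_root q (- (int k * int m))"
  have "dft q f k = (\<Sum>m<q. f (q - m) * ?e (q - m))"
    unfolding dft_def using assms(1,2)
    by (subst sum_lessThan_reflect) (simp_all add: unit_root_eq_1_iff)
  also have "\<dots> = (\<Sum>m<q. f m * ?e' m)"
    using assms(1) even
    by (intro sum.cong refl arg_cong2[where f = "(*)"] unit_root_cong)
       (auto simp: of_nat_diff cong_iff_dvd_diff right_diff_distrib)
  finally have "2 * dft q f k = (\<Sum>m<q. f m * (?e m + ?e' m))"
    by (simp add: dft_def distrib_left sum.distrib)
  moreover have "?e m + ?e' m = 2 * of_real (cos (2 * pi * real k * real m / real q))" for m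
    by (simp add: unit_root_def complex_eq_iff mult.assoc)
  ultimately have "2 * dft q f k = 2 * (\<Sum>m<q. f m * of_real (cos (2 * pi * real k * real m / real q)))"
    by (simp add: sum_distrib_left mult.left_commute)
  then show ?thesis by simp
qed

section \<open>Gauss sums of primitive Dirichlet characters\<close>

lemma coprime_lift:
  fixes n d q :: nat
  assumes n: "coprime n d" and "q > 0"
  shows "\<exists>m. coprime m q \<and> [m = n] (mod d)"
proof -
  define j where "j = \<Prod>{p \<in> prime_factors q. \<not> p dvd n}"
  have dvd_j_iff: "p dvd j \<longleftrightarrow> \<not> p dvd n" if "prime p" "p dvd q" for p
  proof -
    have "p dvd j \<longleftrightarrow> (\<exists>r\<in>{r \<in> prime_factors q. \<not> r dvd n}. p dvd r)"
      unfolding j_def using that(1) by (subst prime_dvd_prod_iff) auto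
    also have "\<dots> \<longleftrightarrow> \<not> p dvd n"
      using that \<open>q > 0\<close> primes_dvd_imp_eq[of p] by (auto simp: in_prime_factors_iff)
    finally show ?thesis .
  qed
  have "coprime (n + j * d) q"
  proof (rule ccontr)
    assume "\<not> coprime (n + j * d) q"
    then have "gcd (n + j * d) q \<noteq> 1" by (simp only: coprime_iff_gcd_eq_1 not_False_eq_True)
    then obtain p where "prime p" "p dvd gcd (n + j * d) q" using prime_factor_nat by blast
    then have p: "prime p" "p dvd n + j * d" "p dvd q" by simp_all
    show False
    proof (cases "p dvd n")
      case True
      then have "p dvd j * d" using p(2) by (simp add: dvd_add_right_iff)
      moreover have "\<not> p dvd d" using n True p(1) by (metis coprime_common_divisor not_prime_unit)
      ultimately show False using dvd_j_iff[OF p(1,3)] p(1) True by (simp add: prime_dvd_mult_iff)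
    next
      case False
      then have "p dvd j * d" using dvd_j_iff[OF p(1,3)] by simp
      then show False using False p(2) by (simp add: dvd_add_left_iff)
    qed
  qed
  moreover have "[n + j * d = n] (mod d)" by (simp add: cong_def)
  ultimately show ?thesis by blast
qed

locale dirichlet_character =
  fixes q :: nat and \<psi> :: "nat \<Rightarrow> complex"
  assumes dirichlet_char: "dirichlet_char q \<psi>"
begin

lemma modulus_pos: "q > 0"
  and char_mult: "\<psi> (m * n) = \<psi> m * \<psi> n"
  and char_plus_modulus: "\<psi> (n + q) = \<psi> n"
  and char_nonzero_iff: "\<psi> n \<noteq> 0 \<longleftrightarrow> coprime n q"
  using dirichlet_char by (auto simp: dirichlet_char_def)

lemma char_eq_0_iff: "\<psi> n = 0 \<longleftrightarrow> \<not> coprime n q"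
  using char_nonzero_iff by blast

lemma char_mod: "\<psi> (n mod q) = \<psi> n"
proof -
  have "\<psi> (r + k * q) = \<psi> r" for r k
  proof (induction k)
    case (Suc k)
    then show ?case using char_plus_modulus[of "r + k * q"] by (simp add: algebra_simps)
  qed simp
  from this[of "n mod q" "n div q"] show ?thesis by simp
qed

lemma char_cong: "[m = n] (mod q) \<Longrightarrow> \<psi> m = \<psi> n"
  by (metis char_mod cong_def)

lemma char_1: "\<psi> 1 = 1"
  using char_nonzero_iff[of 1] char_mult[of 1 1] by simp

lemma char_power: "\<psi> (n ^ k) = \<psi> n ^ k"
  by (induction k) (auto simp: char_1[unfolded One_nat_def] char_mult)

lemma norm_char: "norm (\<psi> n) = (if coprime n q then 1 else 0)"
proof (cases "coprime n q")
  case True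
  have "\<psi> n ^ totient q = \<psi> 1"
    using char_cong[OF euler_theorem[OF True]] by (simp add: char_power)
  then have "norm (\<psi> n) = 1 \<or> totient q = 0" by (intro power_eq_1_iff) (simp only: char_1)
  then show ?thesis using True modulus_pos by simp
qed (simp add: char_eq_0_iff)

lemma norm_char_le_1: "norm (\<psi> n) \<le> 1"
  by (simp add: norm_char)

lemma char_mult_cnj: "coprime n q \<Longrightarrow> \<psi> n * cnj (\<psi> n) = 1"
  by (simp add: norm_char flip: complex_norm_square)

lemma dft_char_twist:
  assumes "coprime a q"
  shows "\<psi> a * dft q \<psi> (k * a) = dft q \<psi> k"
proof -
  let ?f = "\<lambda>m. \<psi> m * unit_root q (int k * int m)"
  have "?f m = ?f n" if "[m = n] (mod q)" for m n
    using that modulus_pos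
    by (intro arg_cong2[where f = "(*)"] char_cong unit_root_cong cong_mult cong_refl)
       (simp_all add: cong_int_iff)
  from sum_residues_mult[OF assms modulus_pos, of ?f, OF this] show ?thesis
    by (simp add: dft_def sum_distrib_left char_mult mult_ac)
qed

lemma dft_char_coprime:
  assumes "coprime k q"
  shows "dft q \<psi> k = cnj (\<psi> k) * dft q \<psi> 1"
proof -
  have "dft q \<psi> k = (\<psi> k * cnj (\<psi> k)) * dft q \<psi> k"
    using assms by (simp only: char_mult_cnj mult_1)
  also have "\<dots> = cnj (\<psi> k) * dft q \<psi> 1"
    using dft_char_twist[OF assms, of 1] by (simp add: mult_ac)
  finally show ?thesis .
qed

definition descend :: "nat \<Rightarrow> nat \<Rightarrow> complex" where
  "descend d n = (if coprime n d then \<psi> (SOME m. coprime m q \<and> [m = n] (mod d)) else 0)"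

context
  fixes d :: nat
  assumes d: "d dvd q" and trivial: "\<And>a. coprime a q \<Longrightarrow> [a = 1] (mod d) \<Longrightarrow> \<psi> a = 1"
begin

lemma char_eq_if_cong_divisor:
  assumes "coprime m q" "coprime n q" "[m = n] (mod d)"
  shows "\<psi> m = \<psi> n"
proof -
  obtain i where i: "[n * i = 1] (mod q)" using cong_solve_coprime_nat[OF assms(2)] by auto
  then have ni: "\<psi> n * \<psi> i = 1" using char_cong[OF i] by (simp only: char_mult char_1)
  then have "coprime i q" by (auto simp flip: char_nonzero_iff)
  have "[m * i = n * i] (mod d)" using assms(3) by (rule cong_mult) auto
  also have "[n * i = 1] (mod d)" using i d by (rule cong_dvd_modulus_nat)
  finally have "\<psi> m * \<psi> i = 1"
    using trivial[of "m * i"] assms(1) \<open>coprime i q\<close> by (simp add: char_mult)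
  then show ?thesis using ni by (metis mult_right_cancel mult_zero_right zero_neq_one)
qed

lemma descend_eq:
  assumes "coprime m q" "[m = n] (mod d)"
  shows "descend d n = \<psi> m"
proof -
  have "coprime m d" using assms(1) d coprime_divisors[of m m d q] by simp
  then have "coprime n d" using assms(2) cong_imp_coprime by blast
  moreover have "coprime (SOME m. coprime m q \<and> [m = n] (mod d)) q \<and> [(SOME m. coprime m q \<and> [m = n] (mod d)) = n] (mod d)"
    by (rule someI[of "\<lambda>m. coprime m q \<and> [m = n] (mod d)" m]) (use assms in blast)
  ultimately show ?thesis
    using assms unfolding descend_def by (auto intro: char_eq_if_cong_divisor cong_trans cong_sym)
qed

lemma dirichlet_char_descend: "dirichlet_char d (descend d)"
  unfolding dirichlet_char_def
proof (intro conjI allI)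
  have lift: "\<exists>m. coprime m q \<and> [m = n] (mod d)" if "coprime n d" for n
    using that modulus_pos by (rule coprime_lift)
  show "d > 0" using modulus_pos d by (rule dvd_pos_nat)
  fix m n
  have plus_d: "coprime (n + d) d \<longleftrightarrow> coprime n d"
    by (simp only: coprime_iff_gcd_eq_1 gcd_add1)
  show "descend d (m * n) = descend d m * descend d n"
  proof (cases "coprime m d \<and> coprime n d")
    case True
    then obtain m' n' where "coprime m' q" "[m' = m] (mod d)" "coprime n' q" "[n' = n] (mod d)"
      using lift by meson
    then show ?thesis
      using descend_eq[of m' m] descend_eq[of n' n] descend_eq[of "m' * n'" "m * n"]
      by (simp add: char_mult cong_mult)
  qed (auto simp: descend_def)
  show "descend d (n + d) = descend d n"
    by (simp add: descend_def plus_d cong_def)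
  show "descend d n \<noteq> 0 \<longleftrightarrow> coprime n d"
  proof (cases "coprime n d")
    case True
    then obtain n' where "coprime n' q" "[n' = n] (mod d)" using lift by blast
    then show ?thesis using True char_nonzero_iff by (simp add: descend_eq)
  qed (simp add: descend_def)
qed

lemma char_eq_descend: "\<psi> n = descend d n * principal_char q n"
  using descend_eq[of n n] char_eq_0_iff[of n] by (simp add: principal_char_def)

end

end

locale primitive_character =
  fixes q :: nat and \<psi> :: "nat \<Rightarrow> complex"
  assumes primitive: "primitive_char q \<psi>" and modulus_gt_1: "q > 1"
begin

sublocale dirichlet_character q \<psi>
  using primitive by unfold_locales (simp add: primitive_char_def)

lemma char_0: "\<psi> 0 = 0"
  using modulus_gt_1 by (simp add: char_eq_0_iff)

lemma nontrivial_on_cong_1: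
  assumes "d dvd q" "d < q"
  obtains a where "coprime a q" "[a = 1] (mod d)" "\<psi> a \<noteq> 1"
proof -
  have "\<not> (\<forall>a. coprime a q \<longrightarrow> [a = 1] (mod d) \<longrightarrow> \<psi> a = 1)"
    using dirichlet_char_descend char_eq_descend primitive assms unfolding primitive_char_def by blast
  then show ?thesis using that by blast
qed

lemma dft_char: "dft q \<psi> k = cnj (\<psi> k) * dft q \<psi> 1"
proof (cases "coprime k q")
  case False
  define g where "g = gcd k q"
  have "g \<noteq> 1" "g > 0" using False modulus_pos unfolding g_def coprime_iff_gcd_eq_1 by simp_all
  obtain d where q: "q = g * d" unfolding g_def by (rule dvdE[OF gcd_dvd2])
  obtain k' where k: "k = g * k'" unfolding g_def by (rule dvdE[OF gcd_dvd1])
  have "d dvd q" "d < q" using q \<open>g \<noteq> 1\<close> \<open>g > 0\<close> modulus_pos by auto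
  then obtain a where a: "coprime a q" "[a = 1] (mod d)" "\<psi> a \<noteq> 1" by (rule nontrivial_on_cong_1)
  have "[g * a = g * 1] (mod (g * d))"
    using a(2) by (simp add: cong_def mult_mod_right[symmetric])
  then have "[k' * (g * a) = k' * (g * 1)] (mod q)"
    unfolding q by (rule cong_mult[OF cong_refl])
  then have "[k * a = k] (mod q)" by (simp add: k mult_ac)
  then have "\<psi> a * dft q \<psi> k = dft q \<psi> k"
    using dft_char_twist[OF a(1), of k] dft_cong[OF _ modulus_pos] by metis
  then have "dft q \<psi> k = 0" using a(3) by simp
  then show ?thesis using False by (simp add: char_eq_0_iff)
qed (rule dft_char_coprime)

lemma dft_char_1_nonzero: "dft q \<psi> 1 \<noteq> 0"
proof
  assume "dft q \<psi> 1 = 0"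
  then have "dft q \<psi> k = 0" for k by (subst dft_char) simp
  then have "of_nat q * \<psi> 1 = 0"
    using dft_inversion[OF modulus_gt_1, of \<psi>] by simp
  then show False using modulus_pos char_1 by simp
qed

end

section \<open>Step functions of even periodic sequences\<close>

definition step_sum :: "nat \<Rightarrow> (nat \<Rightarrow> complex) \<Rightarrow> real \<Rightarrow> complex" where
  "step_sum N f x = (\<Sum>m=1..(N - 1) div 2. f m * (if 2 * real m / real N < x \<and> x < 1 then 1 else 0))"

lemma step_sum_measurable [measurable]: "step_sum N f \<in> borel_measurable borel"
  unfolding step_sum_def by measurable

lemma step_sum_square_integrable: "step_sum N f \<in> square_integrable I01"
proof (rule finite_measure.square_integrable_bounded[OF finite_measure_I01])
  show "norm (step_sum N f x) \<le> (\<Sum>m=1..(N - 1) div 2. norm (f m))" for x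
    unfolding step_sum_def by (rule sum_norm_le) simp
qed measurable

lemma step_sum_odd_periodic: "odd_ext (step_sum N f) \<in> odd_periodic"
  by (intro odd_periodic_odd_ext step_sum_square_integrable) measurable

lemma sum_lessThan_symmetric:
  fixes h :: "nat \<Rightarrow> 'a::comm_semiring_1"
  assumes sym: "\<And>m. m < N \<Longrightarrow> h (N - m) = h m" and zero: "h 0 = 0" and mid: "even N \<Longrightarrow> h (N div 2) = 0"
  shows "(\<Sum>m<N. h m) = 2 * (\<Sum>m=1..(N - 1) div 2. h m)"
proof -
  let ?A = "{1..(N - 1) div 2}"
  let ?B = "(\<lambda>m. N - m) ` ?A"
  have "(\<Sum>m<N. h m) = sum h (?A \<union> ?B)"
  proof (rule sum.mono_neutral_right)
    show "\<forall>x\<in>{..<N} - (?A \<union> ?B). h x = 0"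
    proof
      fix x assume x: "x \<in> {..<N} - (?A \<union> ?B)"
      then have "N - x \<notin> ?A" using imageI[of "N - x" ?A "\<lambda>m. N - m"] by auto
      then have "x = 0 \<or> 2 * x = N" using x by auto
      then show "h x = 0" using zero mid by auto
    qed
  qed auto
  also have "\<dots> = sum h ?A + sum h ?B"
    by (rule sum.union_disjoint) auto
  also have "sum h ?B = sum h ?A"
    by (subst sum.reindex) (auto simp: inj_on_def intro!: sum.cong sym)
  finally show ?thesis by (simp add: mult_2)
qed

lemma LINT_step_mult_sin:
  assumes "0 \<le> a" "a \<le> 1" "k > 0"
  shows "integrable I01 (\<lambda>x. indicator {a<..<1} x * sin (pi * (real k * x)))"
    and "(LINT x|I01. indicator {a<..<1} x * sin (pi * (real k * x))) =
      (cos (pi * (real k * a)) - cos (pi * real k)) / (pi * real k)"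
proof -
  let ?F = "\<lambda>x. - cos (pi * (real k * x)) / (pi * real k)"
  have deriv: "(?F has_real_derivative sin (pi * (real k * x))) (at x)" for x
    using \<open>k > 0\<close> by (auto intro!: derivative_eq_intros)
  show "integrable I01 (\<lambda>x. indicator {a<..<1} x * sin (pi * (real k * x)))"
    by (rule integrable_I01_continuous[OF assms(1,2) deriv]) (intro continuous_intros)
  have "(LINT x|I01. indicator {a<..<1} x * sin (pi * (real k * x))) = ?F 1 - ?F a"
    by (rule LINT_I01_FTC[OF assms(1,2) deriv]) (intro continuous_intros)
  then show "(LINT x|I01. indicator {a<..<1} x * sin (pi * (real k * x))) =
      (cos (pi * (real k * a)) - cos (pi * real k)) / (pi * real k)"
    by (simp add: diff_divide_distrib)
qed

definition partial_sum :: "(nat \<Rightarrow> complex) \<Rightarrow> nat \<Rightarrow> complex" where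
  "partial_sum f M = (\<Sum>m=1..M. f m)"

lemma partial_sum_0 [simp]: "partial_sum f 0 = 0"
  and partial_sum_Suc: "partial_sum f (Suc M) = partial_sum f M + f (Suc M)"
  by (simp_all add: partial_sum_def)

lemma irrational_mult:
  assumes "x \<notin> \<rat>" "a \<in> \<rat>" "a \<noteq> 0"
  shows "a * x \<notin> \<rat>"
proof
  assume "a * x \<in> \<rat>"
  then have "a * x / a \<in> \<rat>" using assms(2) by (rule Rats_divide)
  then show False using assms(1,3) by simp
qed

lemma step_sum_eq_partial_sum:
  assumes x: "0 < x" "x < 1" "x \<notin> \<rat>" and N: "N > 0"
  shows "step_sum N f x = partial_sum f (nat \<lfloor>real N * x / 2\<rfloor>)"
proof -
  define t where "t = real N * x / 2"
  have "real N / 2 * x \<notin> \<rat>" using N by (intro irrational_mult x) auto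
  then have t: "t \<notin> \<rat>" by (simp add: t_def)
  have jump_iff: "2 * real m / real N < x \<longleftrightarrow> m \<le> nat \<lfloor>t\<rfloor>" for m
  proof -
    have "2 * real m / real N < x \<longleftrightarrow> real m < t" using N by (simp add: t_def field_simps)
    also have "\<dots> \<longleftrightarrow> real m \<le> t" using t by (cases "real m = t") auto
    also have "\<dots> \<longleftrightarrow> m \<le> nat \<lfloor>t\<rfloor>" using x by (subst le_nat_iff) (simp_all add: t_def le_floor_iff)
    finally show ?thesis .
  qed
  have "nat \<lfloor>t\<rfloor> \<le> (N - 1) div 2"
  proof -
    have "real (nat \<lfloor>t\<rfloor>) \<le> t" using x by (intro of_nat_floor) (simp add: t_def)
    moreover have "2 * t < real N" using x N by (simp add: t_def)
    ultimately show ?thesis by linarith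
  qed
  then have "(\<Sum>m=1..(N - 1) div 2. f m * (if m \<le> nat \<lfloor>t\<rfloor> then 1 else 0)) = partial_sum f (nat \<lfloor>t\<rfloor>)"
    unfolding partial_sum_def by (intro sum.mono_neutral_cong_right) auto
  then show ?thesis using x(2) by (simp add: step_sum_def jump_iff t_def)
qed

locale even_mean_zero_sequence =
  fixes N :: nat and f :: "nat \<Rightarrow> complex"
  assumes period_pos: "N > 0" and periodic: "f (m + N) = f m"
    and even: "m \<le> N \<Longrightarrow> f (N - m) = f m" and zero: "f 0 = 0"
    and mean_zero: "(\<Sum>m<N. f m) = 0"
begin

lemma at_period: "f N = 0"
  using even[of 0] zero by simp

lemma partial_sum_period: "partial_sum f N = 0"
  using sum_lessThan_Suc_periodic[of f N] mean_zero at_period zero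
  by (simp add: partial_sum_def sum.atLeast1_atMost_eq)

lemma partial_sum_mod: "partial_sum f (M mod N) = partial_sum f M"
proof -
  have step: "partial_sum f (M + N) = partial_sum f M" for M
  proof (induction M)
    case 0
    show ?case by (simp add: partial_sum_period)
  next
    case (Suc M)
    then show ?case using periodic[of "Suc M"] by (simp add: partial_sum_Suc)
  qed
  have "partial_sum f (r + j * N) = partial_sum f r" for r j
  proof (induction j)
    case (Suc j)
    then show ?case using step[of "r + j * N"] by (simp add: algebra_simps)
  qed simp
  from this[of "M mod N" "M div N"] show ?thesis by simp
qed

lemma partial_sum_reflect:
  assumes "M < N"
  shows "partial_sum f (N - Suc M) = - partial_sum f M"
  using assms
proof (induction M)
  case 0
  have "partial_sum f N = partial_sum f (N - 1) + f N"
    using partial_sum_Suc[of f "N - 1"] period_pos by simp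
  then show ?case by (simp add: partial_sum_period at_period)
next
  case (Suc M)
  then have "N - Suc M = Suc (N - Suc (Suc M))" by simp
  then have "partial_sum f (N - Suc M) = partial_sum f (N - Suc (Suc M)) + f (N - Suc M)"
    using partial_sum_Suc[of f "N - Suc (Suc M)"] by simp
  then show ?case using Suc even[of "Suc M"] by (simp add: partial_sum_Suc eq_diff_eq algebra_simps)
qed

definition periodic_partial_sum :: "int \<Rightarrow> complex" where
  "periodic_partial_sum j = partial_sum f (nat (j mod int N))"

lemma periodic_partial_sum_of_nat: "periodic_partial_sum (int M) = partial_sum f M"
  by (simp add: periodic_partial_sum_def nat_mod_distrib partial_sum_mod)

lemma periodic_partial_sum_plus_period: "periodic_partial_sum (j + int N) = periodic_partial_sum j"
  by (simp add: periodic_partial_sum_def)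

lemma periodic_partial_sum_reflect: "periodic_partial_sum (- 1 - j) = - periodic_partial_sum j"
proof -
  have bounds: "0 \<le> j mod int N" "j mod int N < int N" using period_pos by simp_all
  have "(- 1 - j) mod int N = (int N - 1 - j mod int N) mod int N"
    by (simp add: mod_diff_right_eq mod_eq_dvd_iff)
  also have "\<dots> = int N - 1 - j mod int N"
    using bounds by (intro mod_pos_pos_trivial) linarith+
  finally have "nat ((- 1 - j) mod int N) = N - 1 - nat (j mod int N)"
    using bounds by (simp add: nat_diff_distrib)
  moreover have "nat (j mod int N) < N" using bounds by linarith
  ultimately show ?thesis by (simp add: periodic_partial_sum_def partial_sum_reflect)
qed

lemma odd_ext_step_sum:
  assumes x: "x > 0" "x \<notin> \<rat>"
  shows "odd_ext (step_sum N f) x = partial_sum f (nat \<lfloor>real N * x / 2\<rfloor>)"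
proof -
  define g where "g y = periodic_partial_sum \<lfloor>real N * y / 2\<rfloor>" for y
  have g_pos: "g y = partial_sum f (nat \<lfloor>real N * y / 2\<rfloor>)" if "y > 0" for y
    using that periodic_partial_sum_of_nat[of "nat \<lfloor>real N * y / 2\<rfloor>"] by (simp add: g_def)
  have "odd_ext (step_sum N f) x = g x"
  proof (rule odd_ext_unique_irrational[OF _ _ _ x(2)])
    fix y :: real
    show "step_sum N f y = g y" if "0 < y" "y < 1" "y \<notin> \<rat>"
      using step_sum_eq_partial_sum[OF that period_pos] g_pos[OF that(1)] by simp
    have "real N * (y + 2) / 2 = real N * y / 2 + of_int (int N)" by (simp add: field_simps)
    then show "g (y + 2) = g y"
      by (simp only: g_def floor_add_int[symmetric] periodic_partial_sum_plus_period)
    show "g (- y) = - g y" if "y \<notin> \<rat>"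
    proof -
      have "real N / 2 * y \<notin> \<rat>" using period_pos by (intro irrational_mult that) auto
      then have "of_int \<lfloor>real N * y / 2\<rfloor> \<noteq> real N * y / 2" by (metis Rats_of_int times_divide_eq_left)
      then have "\<lfloor>- (real N * y / 2)\<rfloor> = - 1 - \<lfloor>real N * y / 2\<rfloor>" by linarith
      then show ?thesis by (simp add: g_def periodic_partial_sum_reflect)
    qed
  qed
  then show ?thesis using g_pos[OF x(1)] by simp
qed

lemma dft_eq_sum_half_period:
  "dft N f k =
    2 * (\<Sum>m=1..(N - 1) div 2. f m * of_real (cos (2 * pi * real k * real m / real N) - cos (pi * real k)))"
proof -
  let ?h = "\<lambda>m. f m * complex_of_real (cos (2 * pi * real k * real m / real N) - cos (pi * real k))"
  have "?h (N - m) = ?h m" if "m < N" for m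
  proof -
    have "2 * pi * real k * real (N - m) / real N = real k * (2 * pi) - 2 * pi * real k * real m / real N"
      using that by (simp add: of_nat_diff field_simps)
    then have "cos (2 * pi * real k * real (N - m) / real N) = cos (2 * pi * real k * real m / real N)"
      using cos.plus_of_nat[of "- (2 * pi * real k * real m / real N)" k] by simp
    then show ?thesis using even[of m] that by simp
  qed
  moreover have "?h (N div 2) = 0" if "even N"
    using that period_pos by (auto elim!: evenE simp: mult.commute)
  ultimately have "(\<Sum>m<N. ?h m) = 2 * (\<Sum>m=1..(N - 1) div 2. ?h m)"
    by (intro sum_lessThan_symmetric) (simp_all add: zero)
  moreover have "(\<Sum>m<N. ?h m) = dft N f k"
    using dft_even[of N f k] period_pos at_period zero even mean_zero
    by (simp add: right_diff_distrib sum_subtractf flip: sum_distrib_right)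
  ultimately show ?thesis by (simp only:)
qed

lemma sine_coeff_step_sum:
  assumes "k > 0"
  shows "sine_coeff (odd_ext (step_sum N f)) k = dft N f k / of_real (pi * real k)"
proof -
  let ?A = "{1..(N - 1) div 2}"
  let ?s = "\<lambda>m x. indicator {2 * real m / real N<..<1} x * sin (pi * (real k * x))"
  let ?h = "\<lambda>m. f m * of_real (cos (2 * pi * real k * real m / real N) - cos (pi * real k))"
  have range: "0 \<le> 2 * real m / real N" "2 * real m / real N \<le> 1" if "m \<in> ?A" for m
    using that period_pos by (auto simp: field_simps)
  have "odd_ext (step_sum N f) x * sine k x = (\<Sum>m\<in>?A. f m * of_real (?s m x))" if "x \<in> space I01" for x
    using that unfolding step_sum_def
    by (auto simp: space_restrict_space odd_ext_eq sum_distrib_right sine_def intro!: sum.cong)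
  then have "l2_inner I01 (odd_ext (step_sum N f)) (sine k) = (LINT x|I01. (\<Sum>m\<in>?A. f m * of_real (?s m x)))"
    unfolding l2_inner_def by (intro Bochner_Integration.integral_cong) simp_all
  also have "\<dots> = (\<Sum>m\<in>?A. LINT x|I01. f m * of_real (?s m x))"
    by (intro Bochner_Integration.integral_sum integrable_mult_right integrable_of_real
        LINT_step_mult_sin(1) range assms)
  also have "\<dots> = (\<Sum>m\<in>?A. f m * of_real (LINT x|I01. ?s m x))"
    by (simp only: integral_mult_right_zero integral_complex_of_real)
  also have "\<dots> = (\<Sum>m\<in>?A. ?h m) / of_real (pi * real k)"
    unfolding sum_divide_distrib using range assms
    by (intro sum.cong refl) (simp only: LINT_step_mult_sin(2), simp add: mult_ac)
  finally show ?thesis unfolding sine_coeff_def dft_eq_sum_half_period by simp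
qed

end

section \<open>The functions $S_n$\<close>

lemma prime_coprime_iff:
  fixes p m :: nat
  assumes "prime p"
  shows "coprime p m \<longleftrightarrow> \<not> p dvd m"
  using assms prime_imp_coprime[of p m] by (metis coprime_absorb_left not_prime_unit)

locale even_primitive_character = primitive_character +
  assumes even_char: "\<psi> (q - 1) = 1"
begin

lemma char_reflect:
  assumes "q dvd N" "m \<le> N"
  shows "\<psi> (N - m) = \<psi> m"
proof -
  have "(q - 1) * m + m = q * m" using modulus_pos by (simp add: diff_mult_distrib)
  then have "[(q - 1) * m + m = N - m + m] (mod q)"
    using assms by (simp add: cong_def mod_eq_0_iff_dvd)
  then have "[(q - 1) * m = N - m] (mod q)" by (simp only: cong_add_rcancel_nat)
  from char_cong[OF this] show ?thesis by (simp only: char_mult even_char mult_1)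
qed

definition sieved_char :: "nat \<Rightarrow> nat \<Rightarrow> complex" where
  "sieved_char n m = (if coprime m n then \<psi> m else 0)"

lemma sum_sieved_char:
  assumes "n > 0"
  shows "(\<Sum>m<n * q. sieved_char n m) = 0"
proof -
  obtain b where b: "coprime b q" "\<psi> b \<noteq> 1"
    using nontrivial_on_cong_1[of 1] modulus_gt_1 by auto
  have nq: "n * q > 0" using assms modulus_pos by simp
  obtain a where a: "coprime a (n * q)" "[a = b] (mod q)" using coprime_lift[OF b(1) nq] by blast
  have "sieved_char n m = sieved_char n m'" if "[m = m'] (mod n * q)" for m m'
  proof -
    have "coprime m n \<longleftrightarrow> coprime m' n"
      using that cong_imp_coprime cong_sym cong_modulus_mult_nat by blast
    moreover have "\<psi> m = \<psi> m'"
      using that by (intro char_cong cong_modulus_mult_nat[of m m' q n]) (simp add: mult.commute)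
    ultimately show ?thesis by (simp add: sieved_char_def)
  qed
  then have "(\<Sum>m<n * q. sieved_char n (a * m)) = (\<Sum>m<n * q. sieved_char n m)"
    by (rule sum_residues_mult[OF a(1) nq])
  moreover have "sieved_char n (a * m) = \<psi> b * sieved_char n m" for m
    using a(1) char_cong[OF a(2)] by (simp add: sieved_char_def char_mult)
  ultimately have "\<psi> b * (\<Sum>m<n * q. sieved_char n m) = (\<Sum>m<n * q. sieved_char n m)"
    by (simp add: sum_distrib_left)
  then show ?thesis using b(2) by simp
qed

lemma even_mean_zero_sieved_char:
  assumes "n > 0"
  shows "even_mean_zero_sequence (n * q) (sieved_char n)"
proof
  show "n * q > 0" using assms modulus_pos by simp
  show "sieved_char n 0 = 0" by (simp add: sieved_char_def char_0)
  show "(\<Sum>m<n * q. sieved_char n m) = 0" using assms by (rule sum_sieved_char)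
  fix m
  have "\<psi> (m + n * q) = \<psi> m" by (rule char_cong) (simp add: cong_def)
  moreover have "coprime (m + n * q) n \<longleftrightarrow> coprime m n"
    by (simp only: coprime_iff_gcd_eq_1 mult.commute[of n] gcd_add_mult add.commute[of m] gcd.commute[of _ n])
  ultimately show "sieved_char n (m + n * q) = sieved_char n m" by (simp add: sieved_char_def)
  assume m: "m \<le> n * q"
  have "d dvd n * q - m \<longleftrightarrow> d dvd m" if "d dvd n" for d
    using m dvd_mult2[OF that, of q] dvd_diffD1[of d "n * q" m] dvd_diff_nat[of d "n * q" m] by blast
  then have "coprime (n * q - m) n \<longleftrightarrow> coprime m n" unfolding coprime_def by blast
  then show "sieved_char n (n * q - m) = sieved_char n m"
    using m char_reflect[of "n * q" m] by (simp add: sieved_char_def)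
qed

lemma S_fun_eq_step_sum: "S_fun \<psi> q n = step_sum (n * q) (sieved_char n)"
  unfolding S_fun_def step_sum_def sieved_char_def
  by (rule ext, rule sum.mono_neutral_cong_left) auto

abbreviation S :: "nat \<Rightarrow> real \<Rightarrow> complex" where
  "S n \<equiv> odd_ext (S_fun \<psi> q n)"

lemma S_odd_periodic: "S n \<in> odd_periodic"
  unfolding S_fun_eq_step_sum by (rule step_sum_odd_periodic)

lemma S_eq_partial_sum:
  assumes "n > 0" "x > 0" "x \<notin> \<rat>"
  shows "S n x = partial_sum (sieved_char n) (nat \<lfloor>real (n * q) * x / 2\<rfloor>)"
  using even_mean_zero_sequence.odd_ext_step_sum[OF even_mean_zero_sieved_char] assms
  unfolding S_fun_eq_step_sum by blast

definition recursion_coeff :: "nat \<Rightarrow> nat \<Rightarrow> complex" where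
  "recursion_coeff p n = (if p dvd n then 0 else \<psi> p)"

lemma norm_recursion_coeff:
  assumes "prime p"
  shows "norm (recursion_coeff p n) = (if p dvd n \<or> p dvd q then 0 else 1)"
  using assms by (simp add: recursion_coeff_def norm_char char_eq_0_iff prime_coprime_iff)

lemma partial_sum_sieved_prime:
  assumes p: "prime p"
  shows "partial_sum (sieved_char (p * n)) M =
    partial_sum (sieved_char n) M - recursion_coeff p n * partial_sum (sieved_char n) (M div p)"
proof -
  have "p > 0" using p by (rule prime_gt_0_nat)
  have "coprime m (p * n) \<longleftrightarrow> \<not> p dvd m \<and> coprime m n" for m
    using prime_coprime_iff[OF p, of m] by (simp add: coprime_commute)
  then have "sieved_char n m - sieved_char (p * n) m = (if p dvd m then sieved_char n m else 0)" for m
    by (simp add: sieved_char_def)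
  then have "partial_sum (sieved_char n) M - partial_sum (sieved_char (p * n)) M =
      (\<Sum>m\<in>{m \<in> {1..M}. p dvd m}. sieved_char n m)"
    unfolding partial_sum_def sum_subtractf[symmetric] by (simp only: sum.inter_filter finite_atLeastAtMost)
  also have "\<dots> = (\<Sum>j\<in>{1..M div p}. sieved_char n (p * j))"
    unfolding multiples_atMost_eq_image[OF \<open>p > 0\<close>] using \<open>p > 0\<close>
    by (subst sum.reindex) (auto simp: inj_on_def)
  also have "\<dots> = recursion_coeff p n * partial_sum (sieved_char n) (M div p)"
    unfolding partial_sum_def sum_distrib_left
    by (intro sum.cong) (simp_all add: sieved_char_def recursion_coeff_def prime_coprime_iff[OF p] char_mult)
  finally show ?thesis by (simp add: algebra_simps)
qed

lemma S_prime_mult: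
  assumes p: "prime p" and n: "n > 0" and x: "x \<notin> \<rat>"
  shows "S (p * n) x = dil p (S n) x - recursion_coeff p n * S n x"
proof -
  have p_pos: "p > 0" using p by (rule prime_gt_0_nat)
  have pos: "S (p * n) y = dil p (S n) y - recursion_coeff p n * S n y" if y: "y > 0" "y \<notin> \<rat>" for y
  proof -
    let ?M = "nat \<lfloor>real (p * n * q) * y / 2\<rfloor>"
    have "real p * y \<notin> \<rat>" using y(2) p_pos by (intro irrational_mult) auto
    then have "dil p (S n) y = partial_sum (sieved_char n) ?M"
      using S_eq_partial_sum[OF n, of "real p * y"] y(1) p_pos by (simp add: dil_def mult_ac)
    moreover have "nat \<lfloor>real (n * q) * y / 2\<rfloor> = ?M div p"
    proof -
      have "real (n * q) * y / 2 = (real (p * n * q) * y / 2) / real p" using p_pos by simp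
      then have "\<lfloor>real (n * q) * y / 2\<rfloor> = \<lfloor>real (p * n * q) * y / 2\<rfloor> div int p"
        by (metis floor_divide_real_eq_div of_int_of_nat_eq of_nat_0_le_iff)
      then show ?thesis using y(1) by (simp add: nat_div_distrib)
    qed
    ultimately show ?thesis
      using S_eq_partial_sum[OF n y] S_eq_partial_sum[of "p * n" y] n p_pos y
      by (simp add: partial_sum_sieved_prime[OF p])
  qed
  show ?thesis
  proof (cases "x > 0")
    case False
    moreover have "x \<noteq> 0" "- x \<notin> \<rat>" using x by auto
    ultimately show ?thesis using pos[of "- x"] by (simp add: dil_def odd_ext_minus minus_equation_iff[of "S (p * n) x"])
  qed (use pos x in blast)
qed

lemma has_sine_series_S_1:
  "has_sine_series (S 1) (\<lambda>k. dft q \<psi> 1 / of_real pi * (cnj (\<psi> k) / of_nat k))"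
proof -
  have sieved_1: "sieved_char 1 = \<psi>" by (simp add: sieved_char_def fun_eq_iff)
  have "sine_coeff (S 1) k = dft q \<psi> 1 / of_real pi * (cnj (\<psi> k) / of_nat k)" for k
  proof (cases "k = 0")
    case False
    then show ?thesis
      using even_mean_zero_sequence.sine_coeff_step_sum[OF even_mean_zero_sieved_char, of 1 k] dft_char[of k]
      by (simp add: S_fun_eq_step_sum sieved_1[unfolded One_nat_def])
  qed (simp add: sine_coeff_def l2_inner_def)
  then show ?thesis using has_sine_series_sine_coeff[OF S_odd_periodic[of 1]] by presburger
qed

theorem sine_1_mem_if_S_1_mem:
  assumes "closed_invariant_subspace M" "S 1 \<in> M"
  shows "sine 1 \<in> M"
proof -
  interpret closed_invariant_subspace M by fact
  show ?thesis
  proof (rule sine_1_mem[OF has_sine_series_S_1 assms(2)])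
    show "dft q \<psi> 1 / of_real pi \<noteq> 0" using dft_char_1_nonzero by simp
    show "cnj (\<psi> 1) / of_nat 1 = 1" by (simp add: char_1[unfolded One_nat_def])
    show "norm (cnj (\<psi> k) / of_nat k) \<le> 1 / real k" for k
      using norm_char_le_1[of k] by (simp add: norm_divide divide_right_mono)
  qed (simp add: char_mult)
qed

lemma S_mem_if_S_prime_mult_mem:
  assumes "closed_invariant_subspace M" and p: "prime p" and "w > 0" "\<not> p dvd w" "coprime p q"
    and mem: "S (p * w) \<in> M"
  shows "S w \<in> M"
proof -
  interpret closed_invariant_subspace M by fact
  have "\<psi> p \<noteq> 0" using \<open>coprime p q\<close> by (simp add: char_nonzero_iff)
  have "S w - (1 / \<psi> p) *\<^sub>F dil p (S w) \<in> M"
  proof (rule mem_if_eq_on_irrationals)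
    show "(- 1 / \<psi> p) *\<^sub>F S (p * w) \<in> M" using mem by (rule fscale)
    show "S w - (1 / \<psi> p) *\<^sub>F dil p (S w) \<in> odd_periodic"
      using prime_gt_0_nat[OF p]
      by (intro odd_periodic_diff odd_periodic_fscale odd_periodic_dil S_odd_periodic)
    show "(S w - (1 / \<psi> p) *\<^sub>F dil p (S w)) x = ((- 1 / \<psi> p) *\<^sub>F S (p * w)) x" if "x \<notin> \<rat>" for x
      using S_prime_mult[OF p \<open>w > 0\<close> that] \<open>\<not> p dvd w\<close> \<open>\<psi> p \<noteq> 0\<close>
      by (simp add: recursion_coeff_def right_diff_distrib)
  qed
  moreover have "norm (1 / \<psi> p) \<le> 1" using \<open>coprime p q\<close> by (simp add: norm_divide norm_char)
  ultimately show ?thesis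
    using mem_if_diff_dil_mem[OF _ prime_ge_2_nat[OF p] S_odd_periodic] by blast
qed

lemma S_1_mem_if_squarefree:
  assumes "closed_invariant_subspace M" and v: "squarefree v" "coprime v q" "S v \<in> M"
  shows "S 1 \<in> M"
  using v
proof (induction v rule: less_induct)
  case (less v)
  show ?case
  proof (cases "v = 1")
    case False
    then obtain p w where p: "prime p" and v: "v = p * w" by (metis dvdE prime_factor_nat)
    have "w > 0" using less.prems(1) v by (cases w) auto
    have "\<not> p dvd w"
    proof
      assume "p dvd w"
      then have "p\<^sup>2 dvd v" by (simp add: v power2_eq_square)
      then show False using less.prems(1) p unfolding squarefree_def by (metis not_prime_unit)
    qed
    moreover have "coprime p q" "coprime w q" using less.prems(2) by (simp_all add: v)
    ultimately have "S w \<in> M"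
      using less.prems(3) unfolding v by (intro S_mem_if_S_prime_mult_mem[OF assms(1) p \<open>w > 0\<close>])
    moreover have "w < v" using \<open>w > 0\<close> v prime_gt_1_nat[OF p] by simp
    moreover have "squarefree w" using less.prems(1) v squarefree_mono[of w v] by simp
    ultimately show ?thesis using less.IH \<open>coprime w q\<close> by blast
  qed (use less.prems in simp)
qed

theorem cyclic_C_S_squarefree:
  assumes "squarefree v" "coprime v q"
  shows "cyclic_C (S_fun \<psi> q v)"
proof (rule cyclic_C_if_sine_1_mem)
  show "S_fun \<psi> q v \<in> borel_measurable borel" "S_fun \<psi> q v \<in> square_integrable I01"
    by (simp_all add: S_fun_eq_step_sum step_sum_measurable step_sum_square_integrable)
  show "sine 1 \<in> M" if "closed_invariant_subspace M" "S v \<in> M" for M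
    using that assms by (intro sine_1_mem_if_S_1_mem S_1_mem_if_squarefree)
qed

end

section \<open>Linear combinations of the $S_d$\<close>

definition coprime_factorizations :: "nat \<Rightarrow> nat \<Rightarrow> (nat \<times> nat) set" where
  "coprime_factorizations q n = {(a, b). a * b = n \<and> coprime a b \<and> coprime a q}"

lemma finite_coprime_factorizations:
  assumes "n > 0"
  shows "finite (coprime_factorizations q n)"
proof (rule finite_subset)
  show "coprime_factorizations q n \<subseteq> {d. d dvd n} \<times> {d. d dvd n}"
    by (auto simp: coprime_factorizations_def)
qed (use assms in simp)

lemma card_coprime_factorizations_1: "card (coprime_factorizations q 1) = 1"
proof -
  have "coprime_factorizations q 1 = {(1, 1)}" by (auto simp: coprime_factorizations_def)
  then show ?thesis by simp
qed

lemma card_coprime_factorizations_prime_mult_le: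
  assumes p: "prime p" and n: "n > 0"
  shows "card (coprime_factorizations q n) \<le> card (coprime_factorizations q (p * n))"
proof (rule card_inj_on_le)
  let ?F = "coprime_factorizations q"
  define g where "g = (\<lambda>(a, b). if p dvd a then (p * a, b) else (a, p * b))"
  show "inj_on g (?F n)"
    using prime_gt_0_nat[OF p] by (auto simp: g_def inj_on_def split: if_splits)
  show "finite (?F (p * n))"
    using n prime_gt_0_nat[OF p] by (simp add: finite_coprime_factorizations)
  have "g (a, b) \<in> ?F (p * n)" if "(a, b) \<in> ?F n" for a b
  proof (cases "p dvd a")
    case True
    then have "coprime p b" "coprime p q"
      using that coprime_divisors[OF True dvd_refl] by (auto simp: coprime_factorizations_def)
    then show ?thesis using that True by (simp add: g_def coprime_factorizations_def)
  next
    case False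
    then have "coprime a p" using prime_coprime_iff[OF p] by (simp add: coprime_commute)
    then show ?thesis using that False by (auto simp: g_def coprime_factorizations_def)
  qed
  then show "g ` ?F n \<subseteq> ?F (p * n)" by auto
qed

lemma card_coprime_factorizations_new_prime_mult_ge:
  assumes p: "prime p" and n: "n > 0" and "\<not> p dvd n" "\<not> p dvd q"
  shows "2 * card (coprime_factorizations q n) \<le> card (coprime_factorizations q (p * n))"
proof -
  let ?F = "coprime_factorizations q"
  let ?L = "(\<lambda>(a, b). (p * a, b)) ` ?F n" and ?R = "(\<lambda>(a, b). (a, p * b)) ` ?F n"
  have p_pos: "p > 0" using p by (rule prime_gt_0_nat)
  have fin: "finite (?F n)" "finite (?F (p * n))"
    using n p_pos by (simp_all add: finite_coprime_factorizations)
  have "?L \<inter> ?R = {}" "?L \<union> ?R \<subseteq> ?F (p * n)"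
    using \<open>\<not> p dvd n\<close> \<open>\<not> p dvd q\<close>
    by (auto simp: coprime_factorizations_def prime_coprime_iff[OF p] coprime_commute[of _ p])
  moreover have "card ?L = card (?F n)" "card ?R = card (?F n)"
    using p_pos by (auto intro!: card_image simp: inj_on_def)
  ultimately show ?thesis
    using card_mono[OF fin(2), of "?L \<union> ?R"] fin(1) by (simp add: card_Un_disjoint)
qed

lemma Max_coprime_divisor_in:
  fixes u q :: nat
  assumes "u > 0"
  shows "Max {d. d dvd u \<and> coprime d q} \<in> {d. d dvd u \<and> coprime d q}"
  using assms by (intro Max_in finite_subset[OF _ finite_divisors_nat[of u]]) auto

lemma dvd_Max_coprime_divisor:
  fixes u q w :: nat
  assumes u: "u > 0" and w: "w dvd u" "coprime w q"
  shows "w dvd Max {d. d dvd u \<and> coprime d q}"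
proof -
  let ?D = "{d. d dvd u \<and> coprime d q}"
  define m where "m = Max ?D"
  have m: "m \<in> ?D" unfolding m_def using u by (rule Max_coprime_divisor_in)
  have "coprime (lcm w m) q"
    using coprime_divisors[of "lcm w m" "w * m" q q] m w by simp
  then have "lcm w m \<in> ?D" using m w by simp
  moreover have "finite ?D" using u by (intro finite_subset[OF _ finite_divisors_nat[of u]]) auto
  ultimately have "lcm w m \<le> m" unfolding m_def by (intro Max_ge)
  moreover have "lcm w m > 0" using m w u by (auto intro!: Nat.gr0I)
  ultimately have "lcm w m = m" using dvd_imp_le[of m "lcm w m"] by simp
  then show ?thesis unfolding m_def[symmetric] by (metis dvd_lcm1)
qed

text \<open>A pair $(a, b)$ is recovered from $ua/b$, the fraction $a/b$ being reduced.\<close>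

lemma card_coprime_pairs_le_num_divisors:
  assumes u: "u > 0"
  shows "card {(a, b). a * b dvd u \<and> coprime a b \<and> coprime a q}
    \<le> num_divisors (u * Max {d. d dvd u \<and> coprime d q})"
  unfolding num_divisors_def
proof (rule card_inj_on_le)
  let ?F = "{(a, b). a * b dvd u \<and> coprime a b \<and> coprime a q}" and ?u' = "Max {d. d dvd u \<and> coprime d q}"
  define E where "E = (\<lambda>(a, b). u * a div b)"
  have E_mult: "E (a, b) * b = u * a" if "(a, b) \<in> ?F" for a b
    using that by (auto simp: E_def intro!: dvd_div_mult_self dvd_mult2 dest: dvd_mult_right)
  show "inj_on E ?F"
  proof (rule inj_onI, clarify)
    fix a b a' b'
    assume E: "E (a, b) = E (a', b')"
      and dvd: "a * b dvd u" "a' * b' dvd u" and coprime: "coprime a b" "coprime a' b'" "coprime a q" "coprime a' q"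
    have "u * (a * b') = E (a, b) * b * b'" using E_mult[of a b] dvd coprime by simp
    also have "\<dots> = u * (a' * b)" using E_mult[of a' b'] dvd coprime by (simp add: E mult_ac)
    finally have "a * b' = a' * b" using u by simp
    then show "a = a' \<and> b = b'"
      using coprime_crossproduct_nat[of a b a' b'] coprime by simp
  qed
  show "E ` ?F \<subseteq> {e. e dvd u * ?u'}"
  proof clarify
    fix a b assume ab: "a * b dvd u" "coprime a b" "coprime a q"
    then obtain c where u_eq: "u = a * b * c" by blast
    then have "E (a, b) = a * c * a" using u by (simp add: E_def)
    moreover have "a * c dvd u" by (simp add: u_eq)
    moreover have "a dvd ?u'"
      using ab u by (intro dvd_Max_coprime_divisor) (auto dest: dvd_mult_left)
    ultimately show "E (a, b) dvd u * ?u'" by (simp add: mult_dvd_mono)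
  qed
  show "finite {e. e dvd u * ?u'}"
    using u Max_coprime_divisor_in[OF u, of q] dvd_pos_nat[of u ?u'] by simp
qed

lemma sum_card_coprime_factorizations_le:
  assumes u: "u > 0"
  shows "(\<Sum>d\<in>{d. d dvd u}. card (coprime_factorizations q d))
    \<le> num_divisors (u * Max {d. d dvd u \<and> coprime d q})"
proof -
  have "(\<Sum>d\<in>{d. d dvd u}. card (coprime_factorizations q d)) =
      card (\<Union>d\<in>{d. d dvd u}. coprime_factorizations q d)"
    using u dvd_pos_nat[of u]
    by (intro card_UN_disjoint[symmetric] ballI finite_coprime_factorizations)
       (auto simp: coprime_factorizations_def)
  also have "(\<Union>d\<in>{d. d dvd u}. coprime_factorizations q d) =
      {(a, b). a * b dvd u \<and> coprime a b \<and> coprime a q}"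
    by (auto simp: coprime_factorizations_def)
  finally show ?thesis using card_coprime_pairs_le_num_divisors[OF u, of q] by simp
qed

context even_primitive_character
begin

lemma recursion_coeff_card_le:
  assumes p: "prime p" and n: "n > 0"
  shows "(1 + norm (recursion_coeff p n)) * card (coprime_factorizations q n)
    \<le> card (coprime_factorizations q (p * n))"
proof (cases "p dvd n \<or> p dvd q")
  case True
  then show ?thesis
    using card_coprime_factorizations_prime_mult_le[OF assms, of q] by (simp add: norm_recursion_coeff[OF p])
next
  case False
  then have "real (2 * card (coprime_factorizations q n)) \<le> card (coprime_factorizations q (p * n))"
    using card_coprime_factorizations_new_prime_mult_ge[OF assms] by (simp only: of_nat_le_iff) simp
  then show ?thesis using False by (simp add: norm_recursion_coeff[OF p])
qed

lemma S_eq_dilation_polynomial: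
  assumes "n > 0"
  shows "\<exists>A r. dilation_polynomial A r \<and> r \<le> card (coprime_factorizations q n) \<and>
    (\<forall>x. x \<notin> \<rat> \<longrightarrow> S n x = A (S 1) x)"
  using assms
proof (induction n rule: less_induct)
  case (less n)
  show ?case
  proof (cases "n = 1")
    case True
    then show ?thesis
      using dilation_polynomial.ident card_coprime_factorizations_1[of q]
      by (intro exI[of _ "\<lambda>f. f"] exI[of _ 1]) simp
  next
    case False
    then obtain p m where p: "prime p" and n: "n = p * m" by (metis dvdE prime_factor_nat)
    have "m > 0" using less.prems n by simp
    then have "m < n" using n prime_gt_1_nat[OF p] by simp
    obtain A r where A: "dilation_polynomial A r" and r: "r \<le> card (coprime_factorizations q m)"
      and S_m: "\<And>x. x \<notin> \<rat> \<Longrightarrow> S m x = A (S 1) x"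
      using less.IH[OF \<open>m < n\<close> \<open>m > 0\<close>] by blast
    let ?c = "recursion_coeff p m"
    define B where "B f = dil p (A f) + (- ?c) *\<^sub>F A f" for f
    have "dilation_polynomial B (r + norm (- ?c) * r)"
      unfolding B_def using A prime_gt_0_nat[OF p]
      by (intro dilation_polynomial.add dilation_polynomial.dil dilation_polynomial.fscale)
    moreover have "r + norm (- ?c) * r \<le> card (coprime_factorizations q n)"
      using mult_left_mono[OF r, of "1 + norm ?c"] recursion_coeff_card_le[OF p \<open>m > 0\<close>]
      by (simp add: n distrib_right)
    moreover have "S n x = B (S 1) x" if "x \<notin> \<rat>" for x
    proof -
      have "real p * x \<notin> \<rat>" using that prime_gt_0_nat[OF p] by (intro irrational_mult) auto
      then show ?thesis
        using S_prime_mult[OF p \<open>m > 0\<close> that] S_m that by (simp add: n B_def dil_def)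
    qed
    ultimately show ?thesis by blast
  qed
qed

lemma sum_S_eq_dilation_polynomial:
  assumes "0 \<notin> D"
  shows "\<exists>B r. dilation_polynomial B r \<and>
    r \<le> (\<Sum>d\<in>D. norm (b d) * card (coprime_factorizations q d)) \<and>
    (\<forall>x. x \<notin> \<rat> \<longrightarrow> (\<Sum>d\<in>D. b d * S d x) = B (S 1) x)"
proof -
  have "d > 0" if "d \<in> D" for d using that \<open>0 \<notin> D\<close> by (cases d) auto
  then have "\<forall>d\<in>D. \<exists>A r. dilation_polynomial A r \<and> r \<le> card (coprime_factorizations q d) \<and>
      (\<forall>x. x \<notin> \<rat> \<longrightarrow> S d x = A (S 1) x)"
    using S_eq_dilation_polynomial by blast
  then obtain A r where A: "\<And>d. d \<in> D \<Longrightarrow> dilation_polynomial (A d) (r d)"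
      "\<And>d. d \<in> D \<Longrightarrow> r d \<le> card (coprime_factorizations q d)"
      "\<And>d x. d \<in> D \<Longrightarrow> x \<notin> \<rat> \<Longrightarrow> S d x = A d (S 1) x"
    by metis
  define B where "B f = (\<Sum>d\<in>D. b d *\<^sub>F A d f)" for f
  have "dilation_polynomial B (\<Sum>d\<in>D. norm (b d) * r d)"
    unfolding B_def by (intro dilation_polynomial_sum dilation_polynomial.fscale A(1))
  moreover have "(\<Sum>d\<in>D. norm (b d) * r d) \<le>
      (\<Sum>d\<in>D. norm (b d) * card (coprime_factorizations q d))"
    using A(2) by (intro sum_mono mult_left_mono) auto
  moreover have "(\<Sum>d\<in>D. b d * S d x) = B (S 1) x" if "x \<notin> \<rat>" for x
    using A(3)[OF _ that] by (simp add: B_def sum_fun_apply)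
  ultimately show ?thesis by blast
qed

lemma S_1_mem_if_combination_mem:
  assumes "closed_invariant_subspace M" and "finite D" "0 \<notin> D" "1 \<notin> D"
    and dominant: "(\<Sum>d\<in>D. norm (c d) * card (coprime_factorizations q d)) < norm (c 1)"
    and mem: "(\<Sum>d\<in>insert 1 D. c d *\<^sub>F S d) \<in> M"
  shows "S 1 \<in> M"
proof -
  interpret closed_invariant_subspace M by fact
  have "0 \<le> (\<Sum>d\<in>D. norm (c d) * card (coprime_factorizations q d))" by (intro sum_nonneg) auto
  then have c_1_pos: "norm (c 1) > 0" using dominant by linarith
  obtain B r where B: "dilation_polynomial B r"
    and r: "r \<le> (\<Sum>d\<in>D. norm (- c d / c 1) * card (coprime_factorizations q d))"
    and B_eq: "\<And>x. x \<notin> \<rat> \<Longrightarrow> (\<Sum>d\<in>D. - c d / c 1 * S d x) = B (S 1) x"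
    using sum_S_eq_dilation_polynomial[OF \<open>0 \<notin> D\<close>, of "\<lambda>d. - c d / c 1"] by blast
  note r
  also have "(\<Sum>d\<in>D. norm (- c d / c 1) * card (coprime_factorizations q d)) =
      (\<Sum>d\<in>D. norm (c d) * card (coprime_factorizations q d)) / norm (c 1)"
    by (simp add: norm_divide sum_divide_distrib)
  also have "\<dots> < 1" using dominant c_1_pos by simp
  finally have "r < 1" .
  have "S 1 - B (S 1) \<in> M"
  proof (rule mem_if_eq_on_irrationals)
    show "(1 / c 1) *\<^sub>F (\<Sum>d\<in>insert 1 D. c d *\<^sub>F S d) \<in> M" using mem by (rule fscale)
    show "S 1 - B (S 1) \<in> odd_periodic"
      by (intro odd_periodic_diff dilation_polynomial_odd_periodic[OF B] S_odd_periodic)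
    show "(S 1 - B (S 1)) x = ((1 / c 1) *\<^sub>F (\<Sum>d\<in>insert 1 D. c d *\<^sub>F S d)) x" if "x \<notin> \<rat>" for x
    proof -
      have "(1 / c 1) * (\<Sum>d\<in>insert 1 D. c d * S d x) = S 1 x + (\<Sum>d\<in>D. c d / c 1 * S d x)"
        using c_1_pos \<open>finite D\<close> \<open>1 \<notin> D\<close> by (simp add: distrib_left sum_distrib_left)
      also have "(\<Sum>d\<in>D. c d / c 1 * S d x) = - B (S 1) x"
        unfolding B_eq[OF that, symmetric] by (simp add: sum_negf)
      finally show ?thesis by (simp only: fscale_apply sum_fun_apply minus_apply add_uminus_conv_diff)
    qed
  qed
  then show ?thesis using neumann_series_mem[OF B \<open>r < 1\<close> S_odd_periodic] by blast
qed

lemma combination_coeff_bound: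
  fixes c :: "nat \<Rightarrow> complex"
  assumes u: "u > 0" "even u"
    and dominant: "norm (c 1) > (real (num_divisors (u * Max {d. d dvd u \<and> coprime d q})) - 1)
                       * Max ((\<lambda>d. norm (c d)) ` {d. d dvd u \<and> d > 1})"
  shows "(\<Sum>d\<in>{d. d dvd u \<and> d > 1}. norm (c d) * card (coprime_factorizations q d)) < norm (c 1)"
proof -
  let ?D = "{d. d dvd u \<and> d > 1}" and ?w = "\<lambda>d. card (coprime_factorizations q d)"
  define max_coeff where "max_coeff = Max ((\<lambda>d. norm (c d)) ` ?D)"
  have fin: "finite ?D" using u(1) by (intro finite_subset[OF _ finite_divisors_nat[of u]]) auto
  have coeff_le: "norm (c d) \<le> max_coeff" if "d \<in> ?D" for d
    unfolding max_coeff_def using fin that by (intro Max_ge) auto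
  have "2 \<in> ?D" using u by simp
  then have "max_coeff \<ge> 0" using coeff_le norm_ge_zero order_trans by blast
  have "{d. d dvd u} = insert 1 ?D" using u by (auto intro: Nat.gr0I)
  then have "(\<Sum>d\<in>{d. d dvd u}. ?w d) = 1 + (\<Sum>d\<in>?D. ?w d)"
    using fin card_coprime_factorizations_1[of q] by simp
  then have "real (\<Sum>d\<in>?D. ?w d) \<le> real (num_divisors (u * Max {d. d dvd u \<and> coprime d q})) - 1"
    using sum_card_coprime_factorizations_le[OF u(1), of q] by linarith
  then have "max_coeff * real (\<Sum>d\<in>?D. ?w d) < norm (c 1)"
    using dominant mult_left_mono[OF _ \<open>max_coeff \<ge> 0\<close>] by (fastforce simp: max_coeff_def mult.commute)
  moreover have "(\<Sum>d\<in>?D. norm (c d) * ?w d) \<le> (\<Sum>d\<in>?D. max_coeff * ?w d)"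
    using coeff_le by (intro sum_mono mult_right_mono) auto
  ultimately show ?thesis by (simp add: sum_distrib_left)
qed

theorem cyclic_C_S_combination:
  fixes c :: "nat \<Rightarrow> complex"
  assumes u: "u > 0" "even u"
    and dominant: "norm (c 1) > (real (num_divisors (u * Max {d. d dvd u \<and> coprime d q})) - 1)
                       * Max ((\<lambda>d. norm (c d)) ` {d. d dvd u \<and> d > 1})"
  shows "cyclic_C (\<lambda>x. \<Sum>d\<in>{d. d dvd u}. c d * S_fun \<psi> q d x)"
proof -
  let ?D = "{d. d dvd u \<and> d > 1}"
  let ?\<phi> = "\<Sum>d\<in>insert 1 ?D. c d *\<^sub>F S_fun \<psi> q d"
  have D: "{d. d dvd u} = insert 1 ?D" using u by (auto intro: Nat.gr0I)
  have fin: "finite ?D" using u(1) by (intro finite_subset[OF _ finite_divisors_nat[of u]]) auto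
  have "cyclic_C ?\<phi>"
  proof (rule cyclic_C_if_sine_1_mem)
    show "?\<phi> \<in> borel_measurable borel"
      by (simp add: S_fun_eq_step_sum sum_fun_apply cong: measurable_cong)
    show "?\<phi> \<in> square_integrable I01"
      unfolding S_fun_eq_step_sum
      by (intro square_integrable_sum square_integrable_fscale step_sum_square_integrable)
    fix M assume M: "closed_invariant_subspace M" "odd_ext ?\<phi> \<in> M"
    then have "(\<Sum>d\<in>insert 1 ?D. c d *\<^sub>F S d) \<in> M" by (simp only: odd_ext.sum odd_ext.scale)
    then have "S 1 \<in> M"
      using M(1) fin combination_coeff_bound[OF u dominant] by (intro S_1_mem_if_combination_mem[of M ?D c]) auto
    then show "sine 1 \<in> M" by (rule sine_1_mem_if_S_1_mem[OF M(1)])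
  qed
  moreover have "(\<lambda>x. \<Sum>d\<in>{d. d dvd u}. c d * S_fun \<psi> q d x) = ?\<phi>"
    unfolding D by (simp add: fun_eq_iff sum_fun_apply)
  ultimately show ?thesis by simp
qed

end

theorem theorem1p5:
  fixes \<psi> :: "nat \<Rightarrow> complex" and q :: nat
  assumes prim: "primitive_char q \<psi>" and q1: "q > 1" and even: "\<psi> (q - 1) = 1"
  shows "(\<forall>v::nat. v > 0 \<and> squarefree v \<and> coprime v q \<longrightarrow> cyclic_C (S_fun \<psi> q v))
    \<and> (\<forall>(u::nat) (c::nat \<Rightarrow> complex). u > 0 \<and> even u \<and>
         norm (c 1) > (real (num_divisors (u * Max {d. d dvd u \<and> coprime d q})) - 1)
                       * Max ((\<lambda>d. norm (c d)) ` {d. d dvd u \<and> d > 1})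
         \<longrightarrow> cyclic_C (\<lambda>x. \<Sum>d\<in>{d. d dvd u}. c d * S_fun \<psi> q d x))"
proof -
  interpret even_primitive_character q \<psi>
    by unfold_locales (fact prim q1 even)+
  show ?thesis using cyclic_C_S_squarefree cyclic_C_S_combination by blast
qed

end
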